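(* Let $\mathcal{X}=\mathcal{G}\times_{k=1}^d\mathbf{U}_k\in\mathcal{M}_{\leq\mathbf{r}}$ have Tucker rank $\underline{\mathbf{r}}\neq\mathbf{r}$, and let $I=\{k\in[d]:\underline r_k<r_k\}$. Then for all $\mathcal{A}\in\mathbb{R}^{n_1\times\cdots\times n_d}$ the approximate projection $\tilde{\mathrm{P}}_{\mathrm{T}_{\mathcal{X}}\mathcal{M}_{\leq\mathbf{r}}}$ satisfies $$\langle\mathcal{A},\tilde{\mathrm{P}}_{\mathrm{T}_{\mathcal{X}}\mathcal{M}_{\leq\mathbf{r}}}(\mathcal{A})\rangle=\|\tilde{\mathrm{P}}_{\mathrm{T}_{\mathcal{X}}\mathcal{M}_{\leq\mathbf{r}}}(\mathcal{A})\|_{\mathrm{F}}^2$$ and the angle condition $$\langle\mathcal{A},\tilde{\mathrm{P}}_{\mathrm{T}_{\mathcal{X}}\mathcal{M}_{\leq\mathbf{r}}}(\mathcal{A})\rangle\geq\tilde\omega(\mathcal{X})\,\|\mathrm{P}_{\mathrm{T}_{\mathcal{X}}\mathcal{M}_{\leq\mathbf{r}}}(\mathcal{A})\|_{\mathrm{F}}\,\|\tilde{\mathrm{P}}_{\mathrm{T}_{\mathcal{X}}\mathcal{M}_{\leq\mathbf{r}}}(\mathcal{A})\|_{\mathrm{F}},\qquad \tilde\omega(\mathcal{X})=\sqrt{\frac{1}{|I|+1}\prod_{k\in I}\frac{r_k-\underline r_k}{\min\{n_k,n_{-k}\}}}.$$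
   Context: Let $d,n_1,\dots,n_d$ be positive integers, $[d]=\{1,\dots,d\}$, $n_{-k}=\prod_{i\ne k}n_i$, and $\mathbf{r}=(r_1,\dots,r_d)$ positive integers with $r_k\le\min\{n_k,n_{-k}\}$. The mode-$k$ unfolding $\mathbf{X}_{(k)}\in\mathbb{R}^{n_k\times n_{-k}}$ of $\mathcal{X}\in\mathbb{R}^{n_1\times\cdots\times n_d}$ has the mode-$k$ fibers as columns; $(\mathcal{X}\times_k\mathbf{A})_{(k)}=\mathbf{A}\mathbf{X}_{(k)}$ defines the $k$-mode product; $\times_{k\in J}$ and $\times_{j\ne k}$ denote successive products. $\langle\cdot,\cdot\rangle$ and $\|\cdot\|_{\mathrm{F}}$ are the entrywise inner product and Frobenius norm. $\mathrm{St}(r,n)=\{\mathbf{X}\in\mathbb{R}^{n\times r}:\mathbf{X}^\top\mathbf{X}=\mathbf{I}_r\}$; for $\mathbf{S}$ with orthonormal columns, $\mathrm{P}_{\mathbf{S}}=\mathbf{S}\mathbf{S}^\top$ and $\mathrm{P}_{\mathbf{S}}^\perp=\mathbf{I}-\mathbf{S}\mathbf{S}^\top$. Tucker rank: $\mathrm{rank}_{\mathrm{tc}}(\mathcal{X})=(\mathrm{rank}(\mathbf{X}_{(k)}))_{k=1}^d$; $\mathcal{M}_{\leq\mathbf{r}}=\{\mathcal{X}:\mathrm{rank}_{\mathrm{tc}}(\mathcal{X})\leq\mathbf{r}\}$. If $\mathrm{rank}_{\mathrm{tc}}(\mathcal{X})=\underline{\mathbf{r}}$, a Tucker decomposition is $\mathcal{X}=\mathcal{G}\times_{k=1}^d\mathbf{U}_k$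 with $\mathcal{G}\in\mathbb{R}^{\underline r_1\times\cdots\times\underline r_d}$, $\mathbf{U}_k\in\mathrm{St}(\underline r_k,n_k)$ (empty if $\underline r_k=0$); then $\mathbf{G}_{(k)}$ has full row rank and $\mathbf{G}_{(k)}^\dagger=\mathbf{G}_{(k)}^\top(\mathbf{G}_{(k)}\mathbf{G}_{(k)}^\top)^{-1}$. $\mathrm{T}_{\mathcal{X}}\mathcal{M}_{\leq\mathbf{r}}$ is the Bouligand tangent cone (a closed cone), and $\mathrm{P}_{\mathrm{T}_{\mathcal{X}}\mathcal{M}_{\leq\mathbf{r}}}(\mathcal{A})$ is a metric (closest-point) projection of $\mathcal{A}$ onto it; its norm does not depend on the choice of closest point. Approximate projection: given $\mathcal{X}$ and $\mathcal{A}$, choose $\tilde{\mathbf{U}}_{k,1}\in\mathrm{St}(r_k-\underline r_k,n_k)$ for $k\in I$ with $\mathbf{U}_k^\top\tilde{\mathbf{U}}_{k,1}=0$ and $$\|\mathcal{A}\times_{k\in I}\mathrm{P}_{[\mathbf{U}_k\ \tilde{\mathbf{U}}_{k,1}]}\times_{k\in[d]\setminus I}\mathrm{P}_{\mathbf{U}_k}\|_{\mathrm{F}}\geq\|\mathcal{A}\times_{k\in[d]\setminus I}\mathrm{P}_{\mathbf{U}_k}\|_{\mathrm{F}}\prod_{k\in I}\sqrt{\tfrac{r_k-\underline r_k}{\min\{n_k,n_{-k}\}}}$$ (such a choice exists). Let $\tilde{\mathbf{S}}_k=[\mathbf{U}_k\ \tilde{\mathbf{U}}_{k,1}]$ for $k\in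 I$, $\tilde{\mathbf{S}}_k=\mathbf{U}_k$ for $k\notin I$, and $$\tilde{\mathrm{P}}_{\mathrm{T}_{\mathcal{X}}\mathcal{M}_{\leq\mathbf{r}}}(\mathcal{A})=\mathcal{A}\times_{k=1}^d\mathrm{P}_{\tilde{\mathbf{S}}_k}+\sum_{k=1}^d\mathcal{G}\times_k\big(\mathrm{P}^\perp_{\tilde{\mathbf{S}}_k}(\mathcal{A}\times_{j\neq k}\mathbf{U}_j^\top)_{(k)}\mathbf{G}_{(k)}^\dagger\big)\times_{j\neq k}\mathbf{U}_j.$$ *)

theory Defs
  imports
    Complex_Main
    "HOL-Library.FuncSet"
    "Jordan_Normal_Form.DL_Rank"
    "Jordan_Normal_Form.Gauss_Jordan_Elimination"
begin

text \<open>
  Modes are numbered \<open>1, \<dots>, d\<close>; entries within a mode are numbered from \<open>0\<close>, as in the matrix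
  library.  A multi-index is an extensional function on \<open>{1..d}\<close>, and a real \<open>n 1 \<times> \<dots> \<times> n d\<close>
  tensor is a function on multi-indices that vanishes off the index set, so that equality of
  tensors is equality of functions.  Some \<open>n k\<close> may be \<open>0\<close>; the zero function is then the only
  tensor.
\<close>

type_synonym tensor = "(nat \<Rightarrow> nat) \<Rightarrow> real"

definition tensor_indices :: "nat \<Rightarrow> (nat \<Rightarrow> nat) \<Rightarrow> (nat \<Rightarrow> nat) set" where
  "tensor_indices d n = (\<Pi>\<^sub>E k\<in>{1..d}. {..<n k})"

definition tensors :: "nat \<Rightarrow> (nat \<Rightarrow> nat) \<Rightarrow> tensor set" where
  "tensors d n = {X. \<forall>i. i \<notin> tensor_indices d n \<longrightarrow> X i = 0}"

definition tinner :: "nat \<Rightarrow> (nat \<Rightarrow> nat) \<Rightarrow> tensor \<Rightarrow> tensor \<Rightarrow> real" where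
  "tinner d n X Y = (\<Sum>i\<in>tensor_indices d n. X i * Y i)"

definition frob :: "nat \<Rightarrow> (nat \<Rightarrow> nat) \<Rightarrow> tensor \<Rightarrow> real" where
  "frob d n X = sqrt (tinner d n X X)"

definition codim :: "nat \<Rightarrow> (nat \<Rightarrow> nat) \<Rightarrow> nat \<Rightarrow> nat" where
  "codim d n k = (\<Prod>l\<in>{1..d} - {k}. n l)"

text \<open>
  The columns of the mode-\<open>k\<close> unfolding are the mode-\<open>k\<close> fibers in the usual order: the fiber with
  indices \<open>i l\<close> \<open>(l \<noteq> k)\<close> is column \<open>\<Sum>l\<noteq>k. i l * (\<Prod>m<l, m\<noteq>k. n m)\<close>.  \<open>fiber_index d n k i j\<close> is the
  multi-index of entry \<open>(i, j)\<close>, obtained by mixed-radix decoding of \<open>j\<close>.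
\<close>

definition fiber_index :: "nat \<Rightarrow> (nat \<Rightarrow> nat) \<Rightarrow> nat \<Rightarrow> nat \<Rightarrow> nat \<Rightarrow> nat \<Rightarrow> nat" where
  "fiber_index d n k i j =
     (\<lambda>l\<in>{1..d}. if l = k then i else (j div (\<Prod>m\<in>{1..<l} - {k}. n m)) mod n l)"

definition unfold_mat :: "nat \<Rightarrow> (nat \<Rightarrow> nat) \<Rightarrow> nat \<Rightarrow> tensor \<Rightarrow> real mat" where
  "unfold_mat d n k X = mat (n k) (codim d n k) (\<lambda>(i, j). X (fiber_index d n k i j))"

text \<open>
  The size of mode \<open>k\<close> of the product is the number of rows of the matrix.  The equation
  \<open>(X \<times>\<^sub>k A)\<^sub>(\<^sub>k\<^sub>) = A X\<^sub>(\<^sub>k\<^sub>)\<close> is lemma \<open>unfold_mat_mode_prod\<close> below, which determines the product.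
\<close>

definition mode_prod :: "nat \<Rightarrow> real mat \<Rightarrow> tensor \<Rightarrow> tensor" where
  "mode_prod k A X = (\<lambda>i. if i k < dim_row A
     then \<Sum>j<dim_col A. A $$ (i k, j) * X (i(k := j)) else 0)"

text \<open>Successive products; by \<open>mode_prod_commute\<close> below the order of the modes is immaterial.\<close>

definition mode_prods :: "nat set \<Rightarrow> (nat \<Rightarrow> real mat) \<Rightarrow> tensor \<Rightarrow> tensor" where
  "mode_prods J A X = fold (\<lambda>k. mode_prod k (A k)) (sorted_list_of_set J) X"

definition tucker_rank :: "nat \<Rightarrow> (nat \<Rightarrow> nat) \<Rightarrow> tensor \<Rightarrow> nat \<Rightarrow> nat" where
  "tucker_rank d n X k = vec_space.rank (n k) (unfold_mat d n k X)"

definition tucker_variety :: "nat \<Rightarrow> (nat \<Rightarrow> nat) \<Rightarrow> (nat \<Rightarrow> nat) \<Rightarrow> tensor set" where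
  "tucker_variety d n r = {X \<in> tensors d n. \<forall>k\<in>{1..d}. tucker_rank d n X k \<le> r k}"

definition stiefel :: "nat \<Rightarrow> nat \<Rightarrow> real mat set" where
  "stiefel r n = {V \<in> carrier_mat n r. V\<^sup>T * V = 1\<^sub>m r}"

definition proj_mat :: "real mat \<Rightarrow> real mat" where
  "proj_mat S = S * S\<^sup>T"

definition proj_perp_mat :: "real mat \<Rightarrow> real mat" where
  "proj_perp_mat S = 1\<^sub>m (dim_row S) - S * S\<^sup>T"

definition hcat :: "real mat \<Rightarrow> real mat \<Rightarrow> real mat" where
  "hcat B C = four_block_mat B C (0\<^sub>m 0 (dim_col B)) (0\<^sub>m 0 (dim_col C))"

text \<open>The pseudoinverse of a matrix of full row rank.\<close>

definition row_pinv :: "real mat \<Rightarrow> real mat" where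
  "row_pinv B = B\<^sup>T * the (mat_inverse (B * B\<^sup>T))"

definition tucker_decomposition ::
    "nat \<Rightarrow> (nat \<Rightarrow> nat) \<Rightarrow> (nat \<Rightarrow> nat) \<Rightarrow> tensor \<Rightarrow> tensor \<Rightarrow> (nat \<Rightarrow> real mat) \<Rightarrow> bool" where
  "tucker_decomposition d n s X G U \<longleftrightarrow>
     X \<in> tensors d n \<and> (\<forall>k\<in>{1..d}. tucker_rank d n X k = s k) \<and>
     G \<in> tensors d s \<and> (\<forall>k\<in>{1..d}. U k \<in> stiefel (s k) (n k)) \<and>
     X = mode_prods {1..d} U G"

definition tangent_cone :: "nat \<Rightarrow> (nat \<Rightarrow> nat) \<Rightarrow> tensor set \<Rightarrow> tensor \<Rightarrow> tensor set" where
  "tangent_cone d n M X = {V \<in> tensors d n. \<exists>(Y :: nat \<Rightarrow> tensor) (t :: nat \<Rightarrow> real).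
     (\<forall>m. Y m \<in> M) \<and> (\<lambda>m. frob d n (\<lambda>i. Y m i - X i)) \<longlonglongrightarrow> 0 \<and>
     (\<forall>m. t m > 0) \<and> t \<longlonglongrightarrow> 0 \<and>
     (\<lambda>m. frob d n (\<lambda>i. (Y m i - X i) / t m - V i)) \<longlonglongrightarrow> 0}"

definition closest_point_in :: "nat \<Rightarrow> (nat \<Rightarrow> nat) \<Rightarrow> tensor set \<Rightarrow> tensor \<Rightarrow> tensor \<Rightarrow> bool" where
  "closest_point_in d n T A P \<longleftrightarrow>
     P \<in> T \<and> (\<forall>V\<in>T. frob d n (\<lambda>i. A i - P i) \<le> frob d n (\<lambda>i. A i - V i))"

text \<open>
  In the following, \<open>s\<close> is the Tucker rank of the base point, \<open>I\<close> the set of modes with \<open>s k < r k\<close>,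
  and \<open>W k\<close> the chosen matrix with \<open>r k - s k\<close> columns; \<open>W k\<close> is irrelevant for \<open>k \<notin> I\<close>.
\<close>

definition extended_basis :: "nat set \<Rightarrow> (nat \<Rightarrow> real mat) \<Rightarrow> (nat \<Rightarrow> real mat) \<Rightarrow> nat \<Rightarrow> real mat" where
  "extended_basis I U W k = (if k \<in> I then hcat (U k) (W k) else U k)"

definition admissible_choice ::
    "nat \<Rightarrow> (nat \<Rightarrow> nat) \<Rightarrow> (nat \<Rightarrow> nat) \<Rightarrow> (nat \<Rightarrow> nat) \<Rightarrow> nat set \<Rightarrow> (nat \<Rightarrow> real mat) \<Rightarrow> tensor \<Rightarrow>
     (nat \<Rightarrow> real mat) \<Rightarrow> bool" where
  "admissible_choice d n r s I U A W \<longleftrightarrow>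
     (\<forall>k\<in>I. W k \<in> stiefel (r k - s k) (n k) \<and> (U k)\<^sup>T * W k = 0\<^sub>m (s k) (r k - s k)) \<and>
     frob d n (mode_prods ({1..d} - I) (\<lambda>k. proj_mat (U k))
                 (mode_prods I (\<lambda>k. proj_mat (hcat (U k) (W k))) A))
       \<ge> frob d n (mode_prods ({1..d} - I) (\<lambda>k. proj_mat (U k)) A) *
         (\<Prod>k\<in>I. sqrt (real (r k - s k) / real (min (n k) (codim d n k))))"

text \<open>
  \<open>A \<times>\<^sub>j U\<^sub>j\<^sup>T\<close> over all \<open>j \<noteq> k\<close> has size \<open>n k\<close> in mode \<open>k\<close> and \<open>s j\<close> in every other mode, so it is
  unfolded with the sizes \<open>s(k := n k)\<close>.  The columns of this unfolding and of that of \<open>G\<close> are then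
  enumerated in the same order.
\<close>

definition approx_projection ::
    "nat \<Rightarrow> (nat \<Rightarrow> nat) \<Rightarrow> (nat \<Rightarrow> nat) \<Rightarrow> nat set \<Rightarrow> tensor \<Rightarrow> (nat \<Rightarrow> real mat) \<Rightarrow> (nat \<Rightarrow> real mat) \<Rightarrow>
     tensor \<Rightarrow> tensor" where
  "approx_projection d n s I G U W A = (\<lambda>i.
     mode_prods {1..d} (\<lambda>k. proj_mat (extended_basis I U W k)) A i +
     (\<Sum>k\<in>{1..d}.
        mode_prods ({1..d} - {k}) U
          (mode_prod k
             (proj_perp_mat (extended_basis I U W k) *
              unfold_mat d (s(k := n k)) k (mode_prods ({1..d} - {k}) (\<lambda>j. (U j)\<^sup>T) A) *
              row_pinv (unfold_mat d s k G))
             G) i))"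

lemma mode_prod_in_tensors:
  assumes "k \<in> {1..d}" "X \<in> tensors d n" "dim_col A = n k"
  shows "mode_prod k A X \<in> tensors d (n(k := dim_row A))"
proof -
  have "mode_prod k A X i = 0" if i: "i \<notin> tensor_indices d (n(k := dim_row A))" for i
  proof (cases "i k < dim_row A")
    case True
    have "X (i(k := j)) = 0" if "j < dim_col A" for j
    proof -
      have "i(k := j) \<notin> tensor_indices d n"
      proof
        assume a: "i(k := j) \<in> tensor_indices d n"
        have "i \<in> tensor_indices d (n(k := dim_row A))"
          unfolding tensor_indices_def
        proof (rule PiE_I)
          fix l assume l: "l \<in> {1..d}"
          from a have "(i(k := j)) l < n l"
            using l unfolding tensor_indices_def by (auto dest: PiE_mem)
          then show "i l \<in> {..<(n(k := dim_row A)) l}" using True by (auto split: if_splits)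
        next
          fix l assume l: "l \<notin> {1..d}"
          from a have "(i(k := j)) l = undefined"
            using l PiE_arb[of "i(k := j)" "{1..d}"] unfolding tensor_indices_def by blast
          then show "i l = undefined" using l assms(1) by (auto split: if_splits)
        qed
        with i show False by simp
      qed
      then show ?thesis using assms(2) by (simp add: tensors_def)
    qed
    then show ?thesis by (simp add: mode_prod_def)
  qed (simp add: mode_prod_def)
  then show ?thesis by (simp add: tensors_def)
qed

lemma mode_prod_commute:
  assumes "k \<noteq> l"
  shows "mode_prod k A (mode_prod l B X) = mode_prod l B (mode_prod k A X)"
proof
  fix i
  have "(\<Sum>j<dim_col A. A $$ (i k, j) * (\<Sum>m<dim_col B. B $$ (i l, m) * X (i(k := j, l := m)))) =
        (\<Sum>m<dim_col B. B $$ (i l, m) * (\<Sum>j<dim_col A. A $$ (i k, j) * X (i(l := m, k := j))))"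
    using assms
    by (subst (1 2) sum_distrib_left, subst sum.swap) (simp add: fun_upd_twist mult.left_commute)
  then show "mode_prod k A (mode_prod l B X) i = mode_prod l B (mode_prod k A X) i"
    using assms by (simp add: mode_prod_def)
qed

lemma fiber_index_upd:
  "k \<in> {1..d} \<Longrightarrow> (fiber_index d n k i j)(k := a) = fiber_index d n k a j"
  by (auto simp: fiber_index_def)

lemma fiber_index_cong:
  "fiber_index d (n(k := a)) k i j = fiber_index d n k i j"
proof -
  have "(\<Prod>m\<in>{1..<l} - {k}. (n(k := a)) m) = (\<Prod>m\<in>{1..<l} - {k}. n m)" for l
    by (rule prod.cong) auto
  then show ?thesis by (auto simp: fiber_index_def)
qed

lemma unfold_mat_mode_prod:
  assumes "k \<in> {1..d}" "dim_col A = n k"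
  shows "unfold_mat d (n(k := dim_row A)) k (mode_prod k A X) = A * unfold_mat d n k X"
proof -
  have c: "codim d (n(k := a)) k = codim d n k" for a
    unfolding codim_def by (rule prod.cong) auto
  have f: "fiber_index d n k i j k = i" for i j
    using assms(1) by (simp add: fiber_index_def)
  show ?thesis
    by (rule eq_matI)
      (use assms in \<open>auto simp: unfold_mat_def c mode_prod_def fiber_index_cong f fiber_index_upd
          scalar_prod_def lessThan_atLeast0 intro!: sum.cong\<close>)
qed

lemma bij_betw_mixed_radix:
  fixes L :: "nat set"
  assumes "finite L"
  shows "bij_betw (\<lambda>j. \<lambda>l\<in>L. (j div (\<Prod>m\<in>{m\<in>L. m < l}. n m)) mod n l)
           {..<\<Prod>l\<in>L. n l} (\<Pi>\<^sub>E l\<in>L. {..<(n l :: nat)})"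
  using assms
proof (induction L rule: finite_linorder_max_induct)
  case empty
  then show ?case by (auto simp: bij_betw_def inj_on_def)
next
  case (insert b L)
  let ?N = "\<Prod>l\<in>L. n l"
  let ?e = "\<lambda>j. \<lambda>l\<in>L. (j div (\<Prod>m\<in>{m\<in>L. m < l}. n m)) mod n l"
  let ?f = "\<lambda>j. \<lambda>l\<in>insert b L. (j div (\<Prod>m\<in>{m\<in>insert b L. m < l}. n m)) mod n l"
  have bL: "b \<notin> L" using insert.hyps by blast
  have s1: "{m\<in>insert b L. m < l} = {m\<in>L. m < l}" if "l \<in> L" for l
    using insert.hyps that by auto
  have s2: "{m\<in>insert b L. m < b} = L"
    using insert.hyps by auto
  have N: "(\<Prod>l\<in>insert b L. n l) = n b * ?N" using insert.hyps bL by simp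
  have dec: "?f (x + ?N * y) = (?e x)(b := y)" if "x < ?N" "y < n b" for x y
  proof
    fix l
    consider "l = b" | "l \<in> L" "l \<noteq> b" | "l \<notin> insert b L" by blast
    then show "?f (x + ?N * y) l = ((?e x)(b := y)) l"
    proof cases
      case 2
      let ?Q = "\<Prod>m\<in>{m\<in>L. m < l}. n m"
      have "?N = (\<Prod>m\<in>insert l {m\<in>L. m < l}. n m) * (\<Prod>m\<in>L - insert l {m\<in>L. m < l}. n m)"
        using insert.hyps(1) 2
      by (subst prod.subset_diff[of "insert l {m\<in>L. m < l}" L]) (auto simp: mult.commute)
      then obtain R where R: "?N = ?Q * (n l * R)"
        using insert.hyps(1) by (auto simp: mult_ac)
      have "?Q > 0" using that(1) R by (intro Nat.gr0I) auto
      then have "(x + ?N * y) div ?Q = x div ?Q + n l * (R * y)"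
        by (simp add: R mult.assoc)
      then show ?thesis using 2 s1 by simp
    qed (use that s2 in auto)
  qed
  let ?g = "\<lambda>(x, y). x + ?N * y"
  let ?h = "\<lambda>(\<phi>, y). (\<phi> :: nat \<Rightarrow> nat)(b := y)"
  have bg: "bij_betw ?g ({..<?N} \<times> {..<n b}) {..<\<Prod>l\<in>insert b L. n l}"
  proof (rule bij_betw_byWitness[where f' = "\<lambda>j. (j mod ?N, j div ?N)"])
    show "?g ` ({..<?N} \<times> {..<n b}) \<subseteq> {..<\<Prod>l\<in>insert b L. n l}"
    proof (rule image_subsetI)
      fix p assume "p \<in> {..<?N} \<times> {..<n b}"
      then obtain x y where p: "p = (x, y)" and "x < ?N" "y < n b" by auto
      then have "x + ?N * y < ?N * Suc y" by simp
      also have "\<dots> \<le> ?N * n b" using \<open>y < n b\<close> by (intro mult_le_mono2) auto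
      finally show "?g p \<in> {..<\<Prod>l\<in>insert b L. n l}"
        unfolding N p by (simp add: mult.commute)
    qed
    show "(\<lambda>j. (j mod ?N, j div ?N)) ` {..<\<Prod>l\<in>insert b L. n l} \<subseteq> {..<?N} \<times> {..<n b}"
    proof
      fix p assume "p \<in> (\<lambda>j. (j mod ?N, j div ?N)) ` {..<\<Prod>l\<in>insert b L. n l}"
      then obtain j where j: "j < n b * ?N" "p = (j mod ?N, j div ?N)" unfolding N by auto
      then have "?N > 0" by (intro Nat.gr0I) auto
      with j show "p \<in> {..<?N} \<times> {..<n b}" by (simp add: less_mult_imp_div_less)
    qed
  qed auto
  have bh: "bij_betw ?h ((\<Pi>\<^sub>E l\<in>L. {..<n l}) \<times> {..<n b}) (\<Pi>\<^sub>E l\<in>insert b L. {..<n l})"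
  proof (rule bij_betw_byWitness[where f' = "\<lambda>\<psi>. (\<psi>(b := undefined), \<psi> b)"])
    show "\<forall>a\<in>(\<Pi>\<^sub>E l\<in>L. {..<n l}) \<times> {..<n b}. (\<lambda>\<psi>. (\<psi>(b := undefined), \<psi> b)) (?h a) = a"
      using bL by (auto intro!: fun_upd_idem dest: PiE_arb)
  qed (use bL in \<open>auto simp: PiE_def extensional_def Pi_def split: if_splits\<close>)
  have be: "bij_betw (map_prod ?e id) ({..<?N} \<times> {..<n b}) ((\<Pi>\<^sub>E l\<in>L. {..<n l}) \<times> {..<n b})"
    by (rule bij_betw_map_prod[OF insert.IH bij_betw_id])
  have "bij_betw (?h \<circ> map_prod ?e id) ({..<?N} \<times> {..<n b}) (\<Pi>\<^sub>E l\<in>insert b L. {..<n l})"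
    by (rule bij_betw_trans[OF be bh])
  then have "bij_betw (?f \<circ> ?g) ({..<?N} \<times> {..<n b}) (\<Pi>\<^sub>E l\<in>insert b L. {..<n l})"
    by (rule bij_betw_cong[THEN iffD1, rotated]) (use dec in auto)
  then show ?case
    using bij_betw_comp_iff[OF bg] by blast
qed

text \<open>The unfolding lists every entry of the tensor exactly once.\<close>

lemma bij_betw_fiber_index:
  assumes "k \<in> {1..d}"
  shows "bij_betw (\<lambda>(i, j). fiber_index d n k i j)
           ({..<n k} \<times> {..<codim d n k}) (tensor_indices d n)"
proof -
  let ?L = "{1..d} - {k}"
  let ?e = "\<lambda>j. \<lambda>l\<in>?L. (j div (\<Prod>m\<in>{m\<in>?L. m < l}. n m)) mod n l"
  let ?h = "\<lambda>(i, \<phi>). (\<phi> :: nat \<Rightarrow> nat)(k := i)"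
  have "bij_betw ?h ({..<n k} \<times> (\<Pi>\<^sub>E l\<in>?L. {..<n l})) (tensor_indices d n)"
    unfolding tensor_indices_def
  proof (rule bij_betw_byWitness[where f' = "\<lambda>\<psi>. (\<psi> k, \<psi>(k := undefined))"])
    show "\<forall>a\<in>{..<n k} \<times> (\<Pi>\<^sub>E l\<in>?L. {..<n l}). (\<lambda>\<psi>. (\<psi> k, \<psi>(k := undefined))) (?h a) = a"
      by (auto intro!: fun_upd_idem dest: PiE_arb)
  qed (use assms in \<open>auto simp: PiE_def extensional_def Pi_def split: if_splits\<close>)
  moreover have "bij_betw (map_prod id ?e) ({..<n k} \<times> {..<codim d n k})
      ({..<n k} \<times> (\<Pi>\<^sub>E l\<in>?L. {..<n l}))"
    unfolding codim_def
    by (rule bij_betw_map_prod[OF bij_betw_id bij_betw_mixed_radix]) simp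
  ultimately have b: "bij_betw (?h \<circ> map_prod id ?e) ({..<n k} \<times> {..<codim d n k}) (tensor_indices d n)"
    by (rule bij_betw_trans[rotated])
  have eq: "?h (i, ?e j) = fiber_index d n k i j" for i j
  proof -
    have "{m\<in>?L. m < l} = {1..<l} - {k}" if "l \<in> {1..d}" for l using that by auto
    then show ?thesis using assms by (auto simp: fiber_index_def fun_eq_iff)
  qed
  show ?thesis
    by (rule bij_betw_cong[THEN iffD1, OF _ b]) (use eq in \<open>auto simp del: atLeastAtMost_iff\<close>)
qed

end

theory Submission
  imports Defs "HOL-Analysis.L2_Norm"
begin

text \<open>
  Write \<open>P\<^sub>k\<close> for the orthogonal projector onto the enlarged factor space in mode \<open>k\<close> and \<open>P\<^sub>k\<^sup>\<bottom>\<close> for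
  its complement.  Let \<open>core_part A\<close> be \<open>A\<close> multiplied by \<open>P\<^sub>k\<close> in every mode, and call
  \<open>variation k Z\<close> the tensor obtained from the decomposition of \<open>X\<close> by replacing the factor \<open>U k\<close> by
  \<open>Z\<close>.  The approximate projection is the sum of \<open>core_part A\<close> and of one \<open>mode_part k A\<close> for each
  mode.

  \<^bold>\<open>The equality.\<close>  All these summands are mutually orthogonal: \<open>P\<^sub>k\<close> annihilates the \<open>k\<close>-th mode
  part and fixes every other summand.  Moreover \<open>mode_part k A\<close> is the orthogonal projection of \<open>A\<close>
  onto the linear space of variations \<open>variation k Z\<close> with \<open>P\<^sub>k\<^sup>\<bottom> Z = Z\<close> (\<open>tinner_variation\<close>), and
  \<open>core_part A\<close> is an orthogonal projection as well.  So \<open>A\<close> has the same inner product with each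
  summand as the summand has with itself.

  \<^bold>\<open>The angle condition.\<close>  Let \<open>J\<close> be the set of modes in which \<open>X\<close> already has the maximal rank,
  so that \<open>P\<^sub>k\<close> is the projector onto the column space of \<open>U k\<close> for \<open>k \<in> J\<close>.  If matrices of rank
  at most \<open>p\<close> converge to a matrix of rank \<open>p\<close>, the limit of their difference quotients maps the
  kernel of that matrix into its column space (\<open>low_rank_tangent_vanishes\<close>, a computation with a
  determinant of size \<open>p + 1\<close>).  Applied to the unfoldings in the modes \<open>k \<in> J\<close>, this says that
  \<open>P\<^sub>k\<^sup>\<bottom> V\<close> is a variation of \<open>X\<close> in mode \<open>k\<close> for every tangent vector \<open>V\<close>
  (\<open>tangent_full_rank_mode\<close>).  These components can be split off one after the other, and what
  remains is \<open>V\<close> multiplied by \<open>P\<^sub>k\<close> in the modes of \<open>J\<close> (\<open>tangent_vector_decomposition\<close>).  Hence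
  \<open>A\<close> and the tensor \<open>w\<close> that is the sum of \<open>A \<times>\<^sub>k\<^sub>\<in>\<^sub>J P\<^sub>k\<close> and of the mode parts with
  \<open>k \<in> J\<close> have the same inner products with all tangent vectors (\<open>tinner_tangent\<close>).

  A closest point \<open>V\<close> of a cone satisfies \<open>\<parallel>V\<parallel>\<^sup>2 \<le> \<langle>A, V\<rangle> = \<langle>w, V\<rangle>\<close>, so \<open>\<parallel>V\<parallel> \<le> \<parallel>w\<parallel>\<close>.  The
  condition on the chosen matrices compares \<open>A \<times>\<^sub>k\<^sub>\<in>\<^sub>J P\<^sub>k\<close> with \<open>core_part A\<close>; with orthogonality it
  gives \<open>c \<parallel>w\<parallel>\<^sup>2 \<le> \<parallel>projection A\<parallel>\<^sup>2\<close>, where \<open>c \<le> 1\<close> is the product of the ratios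
  (\<open>tangent_projection_bound\<close>).  Since \<open>1 / (|I| + 1) \<le> 1\<close>, the angle condition follows from the
  equality.
\<close>

section \<open>Products of a tensor with matrices\<close>

lemma mode_prod_mode_prod:
  assumes "dim_col B = dim_row C"
  shows "mode_prod k B (mode_prod k C X) = mode_prod k (B * C) X"
proof
  fix i
  have "(\<Sum>j<dim_col B. B $$ (i k, j) * (\<Sum>l<dim_col C. C $$ (j, l) * X (i(k := l)))) =
        (\<Sum>l<dim_col C. (\<Sum>j<dim_col B. B $$ (i k, j) * C $$ (j, l)) * X (i(k := l)))"
    by (subst sum_distrib_left, subst sum.swap) (simp add: sum_distrib_right mult.assoc)
  then show "mode_prod k B (mode_prod k C X) i = mode_prod k (B * C) X i"
    using assms by (simp add: mode_prod_def scalar_prod_def lessThan_atLeast0)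
qed

lemma mode_prod_one:
  assumes "k \<in> {1..d}" "X \<in> tensors d n"
  shows "mode_prod k (1\<^sub>m (n k)) X = X"
proof
  fix i
  have "X i = 0" if "\<not> i k < n k"
  proof -
    have "i \<notin> tensor_indices d n"
      using that assms(1) by (auto simp: tensor_indices_def PiE_iff)
    then show ?thesis using assms(2) by (simp add: tensors_def)
  qed
  then show "mode_prod k (1\<^sub>m (n k)) X i = X i"
    by (auto simp: mode_prod_def if_distrib[of "\<lambda>x. x * _"] if_distribR cong: if_cong)
qed

lemma mode_prod_diff:
  "mode_prod k B (\<lambda>i. X i - Y i) = (\<lambda>i. mode_prod k B X i - mode_prod k B Y i)"
  by (auto simp: mode_prod_def fun_eq_iff right_diff_distrib sum_subtractf)

lemma mode_prod_sum:
  "mode_prod k B (\<lambda>i. \<Sum>j\<in>J. X j i) = (\<lambda>i. \<Sum>j\<in>J. mode_prod k B (X j) i)"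
proof
  fix i
  show "mode_prod k B (\<lambda>i. \<Sum>j\<in>J. X j i) i = (\<Sum>j\<in>J. mode_prod k B (X j) i)"
    by (simp add: mode_prod_def sum_distrib_left) (rule impI, rule sum.swap)
qed

lemma mode_prod_zero_tensor: "mode_prod k B (\<lambda>i. 0) = (\<lambda>i. 0)"
  by (simp add: mode_prod_def fun_eq_iff)

lemma mode_prod_zero_mat: "mode_prod k (0\<^sub>m p q) X = (\<lambda>i. 0)"
  by (auto simp: mode_prod_def fun_eq_iff)

lemma mode_prod_minus_mat:
  assumes "B \<in> carrier_mat p q" "C \<in> carrier_mat p q"
  shows "mode_prod k (B - C) X = (\<lambda>i. mode_prod k B X i - mode_prod k C X i)"
  using assms by (auto simp: mode_prod_def fun_eq_iff left_diff_distrib sum_subtractf)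

text \<open>
  This turns a successive product into a fold over a finite set, from which modes can be split off in
  any order.
\<close>

lemma comp_fun_commute_mode_prod: "comp_fun_commute (\<lambda>k. mode_prod k (B k))"
proof
  fix k l
  show "mode_prod l (B l) \<circ> mode_prod k (B k) = mode_prod k (B k) \<circ> mode_prod l (B l)"
    by (cases "k = l") (simp_all add: fun_eq_iff mode_prod_commute)
qed

lemma mode_prods_eq_fold:
  assumes "finite J"
  shows "mode_prods J B X = Finite_Set.fold (\<lambda>k. mode_prod k (B k)) X J"
proof -
  interpret comp_fun_commute "\<lambda>k. mode_prod k (B k)"
    by (rule comp_fun_commute_mode_prod)
  show ?thesis
    using fold_set_fold_remdups[where xs = "sorted_list_of_set J" and y = X] assms
    by (simp add: mode_prods_def distinct_remdups_id)
qed

lemma mode_prods_empty [simp]: "mode_prods {} B X = X"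
  by (simp add: mode_prods_def)

lemma mode_prods_insert:
  assumes "finite J" "k \<notin> J"
  shows "mode_prods (insert k J) B X = mode_prod k (B k) (mode_prods J B X)"
proof -
  interpret comp_fun_commute "\<lambda>k. mode_prod k (B k)"
    by (rule comp_fun_commute_mode_prod)
  show ?thesis using assms by (simp add: mode_prods_eq_fold)
qed

lemma mode_prods_remove:
  assumes "finite J" "k \<in> J"
  shows "mode_prods J B X = mode_prod k (B k) (mode_prods (J - {k}) B X)"
  using mode_prods_insert[of "J - {k}" k B X] assms by (simp add: insert_absorb)

lemma mode_prods_cong:
  assumes "finite J" "\<And>k. k \<in> J \<Longrightarrow> B k = C k"
  shows "mode_prods J B X = mode_prods J C X"
  using assms by (induction J rule: finite_induct) (simp_all add: mode_prods_insert)

lemma mode_prod_mode_prods: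
  assumes "finite J" "k \<notin> J"
  shows "mode_prod k C (mode_prods J B X) = mode_prods J B (mode_prod k C X)"
  using assms
proof (induction J rule: finite_induct)
  case (insert l J)
  then show ?case
    by (simp add: mode_prods_insert mode_prod_commute[of k l])
qed simp

lemma mode_prods_union:
  assumes "finite J" "finite K" "J \<inter> K = {}"
  shows "mode_prods (J \<union> K) B X = mode_prods J B (mode_prods K B X)"
  using assms by (induction J rule: finite_induct) (simp_all add: mode_prods_insert)

lemma mode_prods_mode_prods:
  assumes "finite J" "\<And>k. k \<in> J \<Longrightarrow> dim_col (B k) = dim_row (C k)"
  shows "mode_prods J B (mode_prods J C X) = mode_prods J (\<lambda>k. B k * C k) X"
  using assms
proof (induction J rule: finite_induct)
  case (insert k J)
  then show ?case
    by (simp add: mode_prods_insert mode_prod_mode_prods[symmetric] mode_prod_mode_prod)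
qed simp

lemma mode_prods_zero_tensor:
  assumes "finite J"
  shows "mode_prods J B (\<lambda>i. 0) = (\<lambda>i. 0)"
  using assms
  by (induction J rule: finite_induct) (simp_all add: mode_prods_insert mode_prod_zero_tensor)

lemma mode_prods_in_tensors:
  assumes "finite J" "J \<subseteq> {1..d}" "X \<in> tensors d n" "\<And>k. k \<in> J \<Longrightarrow> dim_col (B k) = n k"
  shows "mode_prods J B X \<in> tensors d (\<lambda>k. if k \<in> J then dim_row (B k) else n k)"
  using assms
proof (induction J rule: finite_induct)
  case (insert k J)
  let ?m = "\<lambda>l. if l \<in> J then dim_row (B l) else n l"
  have "mode_prod k (B k) (mode_prods J B X) \<in> tensors d (?m(k := dim_row (B k)))"
    using insert by (intro mode_prod_in_tensors) auto
  also have "?m(k := dim_row (B k)) = (\<lambda>l. if l \<in> insert k J then dim_row (B l) else n l)"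
    by auto
  finally show ?case
    using insert by (simp add: mode_prods_insert)
qed simp

lemma mode_prods_one:
  assumes "finite J" "J \<subseteq> {1..d}" "X \<in> tensors d n"
    and B: "\<And>k. k \<in> J \<Longrightarrow> B k = 1\<^sub>m (n k)"
  shows "mode_prods J B X = X"
proof -
  have "mode_prods J (\<lambda>k. 1\<^sub>m (n k)) X = X"
    using assms(1,2)
  proof (induction J rule: finite_induct)
    case (insert k J)
    then show ?case using assms(3) by (simp add: mode_prods_insert mode_prod_one[where d = d])
  qed simp
  then show ?thesis using mode_prods_cong[of J B "\<lambda>k. 1\<^sub>m (n k)" X, OF assms(1) B] by simp
qed

section \<open>Inner product, norm and unfolding\<close>

lemma finite_tensor_indices [simp]: "finite (tensor_indices d n)"
  by (simp add: tensor_indices_def finite_PiE)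

lemma tensor_indices_cong:
  "(\<And>k. k \<in> {1..d} \<Longrightarrow> m k = n k) \<Longrightarrow> tensor_indices d m = tensor_indices d n"
  unfolding tensor_indices_def by (rule PiE_cong) simp

lemma tinner_cong:
  "(\<And>k. k \<in> {1..d} \<Longrightarrow> m k = n k) \<Longrightarrow> tinner d m X Y = tinner d n X Y"
  unfolding tinner_def using tensor_indices_cong[of d m n] by simp

lemma tensors_cong:
  "(\<And>k. k \<in> {1..d} \<Longrightarrow> m k = n k) \<Longrightarrow> tensors d m = tensors d n"
  unfolding tensors_def using tensor_indices_cong[of d m n] by simp

lemma tinner_eq_fibers:
  assumes "k \<in> {1..d}"
  shows "tinner d n X Y =
    (\<Sum>i<n k. \<Sum>j<codim d n k. X (fiber_index d n k i j) * Y (fiber_index d n k i j))"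
  using sum.reindex_bij_betw[OF bij_betw_fiber_index[OF assms, of n], of "\<lambda>i. X i * Y i"]
  by (simp add: tinner_def sum.cartesian_product case_prod_unfold)

lemma codim_upd: "codim d (n(k := a)) k = codim d n k"
  unfolding codim_def by (rule prod.cong) auto

lemma fiber_index_mode:
  "k \<in> {1..d} \<Longrightarrow> fiber_index d n k i j k = i"
  by (simp add: fiber_index_def)

text \<open>
  Along a single fiber this is the adjointness of a matrix and its transpose; by the bijection
  between entries and fibers the inner product is the sum over all fibers.
\<close>

lemma tinner_mode_prod:
  assumes k: "k \<in> {1..d}" and B: "B \<in> carrier_mat p (n k)"
  shows "tinner d (n(k := p)) X (mode_prod k B Y) = tinner d n (mode_prod k B\<^sup>T X) Y"
proof -
  let ?f = "fiber_index d n k"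
  have "tinner d (n(k := p)) X (mode_prod k B Y) =
      (\<Sum>i<p. \<Sum>j<codim d n k. X (?f i j) * (\<Sum>l<n k. B $$ (i, l) * Y (?f l j)))"
    using B k by (simp add: tinner_eq_fibers[OF k] codim_upd fiber_index_cong mode_prod_def
        fiber_index_mode fiber_index_upd)
  also have "\<dots> = (\<Sum>j<codim d n k. \<Sum>i<p. \<Sum>l<n k. B $$ (i, l) * X (?f i j) * Y (?f l j))"
    by (subst sum.swap) (simp add: sum_distrib_left mult_ac)
  also have "\<dots> = (\<Sum>j<codim d n k. \<Sum>l<n k. \<Sum>i<p. B $$ (i, l) * X (?f i j) * Y (?f l j))"
    by (intro sum.cong refl sum.swap)
  also have "\<dots> = (\<Sum>l<n k. \<Sum>j<codim d n k. (\<Sum>i<p. B $$ (i, l) * X (?f i j)) * Y (?f l j))"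
    by (subst sum.swap) (simp add: sum_distrib_right)
  also have "\<dots> = tinner d n (mode_prod k B\<^sup>T X) Y"
    using B k by (simp add: tinner_eq_fibers[OF k] mode_prod_def fiber_index_mode fiber_index_upd)
  finally show ?thesis .
qed

lemma tinner_mode_prods:
  assumes "finite J" "J \<subseteq> {1..d}" "\<And>k. k \<in> J \<Longrightarrow> B k \<in> carrier_mat (m k) (n k)"
    and "\<And>k. k \<in> {1..d} - J \<Longrightarrow> m k = n k"
  shows "tinner d m X (mode_prods J B Y) = tinner d n (mode_prods J (\<lambda>k. (B k)\<^sup>T) X) Y"
  using assms
proof (induction J arbitrary: m X rule: finite_induct)
  case empty
  then show ?case using tinner_cong[of d m n] by simp
next
  case (insert k J)
  let ?m = "m(k := n k)"
  have "tinner d m X (mode_prods (insert k J) B Y) =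
      tinner d (?m(k := m k)) X (mode_prod k (B k) (mode_prods J B Y))"
    using insert.hyps by (simp add: mode_prods_insert)
  also have "\<dots> = tinner d ?m (mode_prod k (B k)\<^sup>T X) (mode_prods J B Y)"
    using insert.prems by (intro tinner_mode_prod) auto
  also have "\<dots> = tinner d n (mode_prods J (\<lambda>k. (B k)\<^sup>T) (mode_prod k (B k)\<^sup>T X)) Y"
    using insert.prems insert.hyps by (intro insert.IH) auto
  also have "\<dots> = tinner d n (mode_prods (insert k J) (\<lambda>k. (B k)\<^sup>T) X) Y"
    using insert.hyps by (simp add: mode_prods_insert mode_prod_mode_prods)
  finally show ?case .
qed

lemma tinner_commute: "tinner d n X Y = tinner d n Y X"
  by (simp add: tinner_def mult.commute)

lemma tinner_diff_left: "tinner d n (\<lambda>i. X i - Y i) Z = tinner d n X Z - tinner d n Y Z"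
  by (simp add: tinner_def left_diff_distrib sum_subtractf)

lemma tinner_diff_right: "tinner d n Z (\<lambda>i. X i - Y i) = tinner d n Z X - tinner d n Z Y"
  by (simp add: tinner_def right_diff_distrib sum_subtractf)

lemma tinner_add_left: "tinner d n (\<lambda>i. X i + Y i) Z = tinner d n X Z + tinner d n Y Z"
  by (simp add: tinner_def distrib_right sum.distrib)

lemma tinner_add_right: "tinner d n Z (\<lambda>i. X i + Y i) = tinner d n Z X + tinner d n Z Y"
  by (simp add: tinner_def distrib_left sum.distrib)

lemma tinner_sum_left: "tinner d n (\<lambda>i. \<Sum>k\<in>J. X k i) Z = (\<Sum>k\<in>J. tinner d n (X k) Z)"
  unfolding tinner_def sum_distrib_right by (rule sum.swap)

lemma tinner_sum_right: "tinner d n Z (\<lambda>i. \<Sum>k\<in>J. X k i) = (\<Sum>k\<in>J. tinner d n Z (X k))"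
  by (simp add: tinner_commute[of d n Z] tinner_sum_left)

lemma tinner_scale_right: "tinner d n X (\<lambda>i. c * Y i) = c * tinner d n X Y"
  by (simp add: tinner_def sum_distrib_left mult_ac)

lemma tinner_self_nonneg: "tinner d n X X \<ge> 0"
  by (simp add: tinner_def sum_nonneg)

lemma frob_nonneg: "frob d n X \<ge> 0"
  by (simp add: frob_def tinner_self_nonneg)

lemma frob_squared: "(frob d n X)\<^sup>2 = tinner d n X X"
  by (simp add: frob_def tinner_self_nonneg)

lemma tinner_Cauchy_Schwarz: "tinner d n X Y \<le> frob d n X * frob d n Y"
proof -
  let ?J = "tensor_indices d n"
  have "tinner d n X Y \<le> (\<Sum>i\<in>?J. \<bar>X i\<bar> * \<bar>Y i\<bar>)"
    unfolding tinner_def by (intro sum_mono) (simp add: abs_mult[symmetric])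
  also have "\<dots> \<le> L2_set X ?J * L2_set Y ?J"
    by (rule L2_set_mult_ineq)
  finally show ?thesis
    by (simp add: frob_def tinner_def L2_set_def power2_eq_square)
qed

lemma abs_le_frob:
  assumes "i \<in> tensor_indices d n"
  shows "\<bar>X i\<bar> \<le> frob d n X"
proof -
  have "(X i)\<^sup>2 \<le> tinner d n X X"
    unfolding tinner_def power2_eq_square using assms by (intro member_le_sum) auto
  then show ?thesis by (simp add: frob_def real_le_rsqrt)
qed

text \<open>
  A symmetric matrix can be moved from one argument of the inner product to the other.
\<close>

lemma tinner_eq_0_if_fixed_killed:
  assumes k: "k \<in> {1..d}" and B: "B \<in> carrier_mat (n k) (n k)" "B\<^sup>T = B"
    and X: "mode_prod k B X = X" and Y: "mode_prod k B Y = (\<lambda>i. 0)"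
  shows "tinner d n X Y = 0"
proof -
  have "tinner d n X Y = tinner d n (mode_prod k B\<^sup>T X) Y" using B X by simp
  also have "\<dots> = tinner d (n(k := n k)) X (mode_prod k B Y)"
    using B by (intro tinner_mode_prod[OF k, symmetric]) auto
  finally show ?thesis using Y by (simp add: tinner_def)
qed

lemma unfold_mat_carrier [simp]: "unfold_mat d n k X \<in> carrier_mat (n k) (codim d n k)"
  by (simp add: unfold_mat_def)

lemma unfold_mat_inject:
  assumes k: "k \<in> {1..d}" and X: "X \<in> tensors d n" and Y: "Y \<in> tensors d n"
    and eq: "unfold_mat d n k X = unfold_mat d n k Y"
  shows "X = Y"
proof
  fix i
  show "X i = Y i"
  proof (cases "i \<in> tensor_indices d n")
    case True
    then have "i \<in> (\<lambda>(a, b). fiber_index d n k a b) ` ({..<n k} \<times> {..<codim d n k})"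
      using bij_betw_fiber_index[OF k, of n] by (simp add: bij_betw_def)
    then obtain a b where "a < n k" "b < codim d n k" "i = fiber_index d n k a b"
      by auto
    then show ?thesis
      using arg_cong[OF eq, of "\<lambda>M. M $$ (a, b)"] by (simp add: unfold_mat_def)
  qed (use X Y in \<open>simp add: tensors_def\<close>)
qed

lemma tinner_eq_trace:
  assumes "k \<in> {1..d}"
  shows "tinner d n X Y = (\<Sum>a<n k. (unfold_mat d n k X * (unfold_mat d n k Y)\<^sup>T) $$ (a, a))"
  by (simp add: tinner_eq_fibers[OF assms] unfold_mat_def scalar_prod_def lessThan_atLeast0)

lemma unfold_mat_diff:
  "unfold_mat d n k (\<lambda>i. X i - Y i) = unfold_mat d n k X - unfold_mat d n k Y"
  by (rule eq_matI) (simp_all add: unfold_mat_def)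

lemma frob_scale: "frob d n (\<lambda>i. c * X i) = \<bar>c\<bar> * frob d n X"
proof -
  have "tinner d n (\<lambda>i. c * X i) (\<lambda>i. c * X i) = c\<^sup>2 * tinner d n X X"
    by (simp add: tinner_def sum_distrib_left power2_eq_square mult_ac)
  then show ?thesis by (simp add: frob_def real_sqrt_mult)
qed

lemma tinner_orthogonal_sum:
  assumes "finite J"
    and FT: "\<And>k. k \<in> J \<Longrightarrow> tinner d n F (T k) = 0"
    and TT: "\<And>k l. k \<in> J \<Longrightarrow> l \<in> J \<Longrightarrow> k \<noteq> l \<Longrightarrow> tinner d n (T k) (T l) = 0"
  shows "tinner d n (\<lambda>i. F i + (\<Sum>k\<in>J. T k i)) (\<lambda>i. F i + (\<Sum>k\<in>J. T k i)) =
    tinner d n F F + (\<Sum>k\<in>J. tinner d n (T k) (T k))"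
proof -
  have "(\<Sum>k\<in>J. \<Sum>l\<in>J. tinner d n (T k) (T l)) = (\<Sum>k\<in>J. tinner d n (T k) (T k))"
  proof (rule sum.cong[OF refl])
    fix k assume k: "k \<in> J"
    have "(\<Sum>l\<in>J. tinner d n (T k) (T l)) = (\<Sum>l\<in>J. if k = l then tinner d n (T k) (T k) else 0)"
      using TT[OF k] by (intro sum.cong) auto
    then show "(\<Sum>l\<in>J. tinner d n (T k) (T l)) = tinner d n (T k) (T k)"
      using assms(1) k by simp
  qed
  moreover have "tinner d n (T k) F = 0" if "k \<in> J" for k
    using FT[OF that] by (simp add: tinner_commute)
  ultimately show ?thesis
    using FT by (simp add: tinner_add_left tinner_add_right tinner_sum_left tinner_sum_right)
qed

section \<open>Matrices of bounded rank and their limits\<close>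

text \<open>
  The product \<open>Y * R\<close> selects a maximal independent set of columns of \<open>Y\<close>, and \<open>D\<close> holds the
  coordinates of all columns with respect to it.  Selecting columns by a right multiplication makes
  it possible to transfer injectivity to right factors of \<open>Y\<close>.
\<close>

lemma rank_factorization:
  fixes Y :: "'a :: field mat"
  assumes Y: "Y \<in> carrier_mat n N" and s: "s = vec_space.rank n Y"
  obtains R D where "R \<in> carrier_mat N s" "D \<in> carrier_mat s N" "Y = Y * R * D"
    "\<And>x. x \<in> carrier_vec s \<Longrightarrow> (Y * R) *\<^sub>v x = 0\<^sub>v n \<Longrightarrow> x = 0\<^sub>v s"
proof -
  interpret vec_space "TYPE('a)" n .
  obtain S where S: "finite S" "maximal S (\<lambda>T. T \<subseteq> set (cols Y) \<and> lin_indpt T)"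
    using maximal_exists[of "\<lambda>T. T \<subseteq> set (cols Y) \<and> lin_indpt T" "card (set (cols Y))" "{}"]
    by (meson List.finite_set card_mono empty_iff empty_subsetI finite_lin_indpt2 rev_finite_subset)
  have SY: "S \<subseteq> set (cols Y)" and li: "lin_indpt S"
    using S(2) by (auto simp: maximal_def)
  have dimY: "set (cols Y) \<subseteq> carrier_vec n"
    using Y cols_dim by blast
  obtain xs where xs: "set xs = S" "distinct xs"
    using finite_distinct_list[OF S(1)] by blast
  have len: "length xs = s"
    using rank_card_indpt[OF Y S(2)] s xs distinct_card[OF xs(2)] by simp
  have "\<exists>p<N. col Y p = xs ! l" if "l < s" for l
  proof -
    have "xs ! l \<in> set (cols Y)" using SY xs(1) that len nth_mem[of l xs] by blast
    then show ?thesis using Y by (auto simp: cols_def)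
  qed
  then obtain p where p: "\<And>l. l < s \<Longrightarrow> p l < N \<and> col Y (p l) = xs ! l"
    by metis
  define C where "C = mat_of_cols n xs"
  define R :: "'a mat" where "R = mat N s (\<lambda>(b, l). if b = p l then 1 else 0)"
  have C: "C \<in> carrier_mat n s" by (simp add: C_def len mat_of_cols_def)
  have R: "R \<in> carrier_mat N s" by (simp add: R_def)
  have "set xs \<subseteq> carrier_vec n" using xs(1) SY dimY by blast
  then have colsC: "cols C = xs" by (simp add: C_def cols_mat_of_cols)
  have YR: "Y * R = C"
  proof (rule eq_matI)
    fix i l assume "i < dim_row C" "l < dim_col C"
    then have il: "i < n" "l < s" using C by auto
    have "(Y * R) $$ (i, l) = (\<Sum>b = 0..<N. Y $$ (i, b) * (if b = p l then 1 else 0))"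
      using il Y by (auto simp: R_def scalar_prod_def intro!: sum.cong)
    also have "\<dots> = (\<Sum>b = 0..<N. if b = p l then Y $$ (i, b) else 0)"
      by (intro sum.cong) auto
    also have "\<dots> = Y $$ (i, p l)" using p il by simp
    also have "\<dots> = C $$ (i, l)"
      using p[OF il(2)] il Y C len by (auto simp: C_def mat_of_cols_def dest: arg_cong[of _ _ "\<lambda>v. v $ i"])
    finally show "(Y * R) $$ (i, l) = C $$ (i, l)" .
  qed (use C R Y in auto)
  have "\<exists>w. w \<in> carrier_vec s \<and> C *\<^sub>v w = col Y j" if "j < N" for j
  proof -
    have cj: "col Y j \<in> set (cols Y)" using that Y by (auto simp: cols_def)
    have "col Y j \<in> span S"
    proof (cases "col Y j \<in> S")
      case True
      then show ?thesis using span_mem SY dimY by blast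
    next
      case False
      then have "\<not> lin_indpt (S \<union> {col Y j})"
        using S(2) SY cj unfolding maximal_def by blast
      then show ?thesis
        using lin_dep_iff_in_span[of S "col Y j"] li False SY dimY cj by blast
    qed
    then obtain a where "lincomb a S = col Y j"
      using finite_in_span[of S "col Y j"] S(1) SY dimY by blast
    then have "C *\<^sub>v vec s (\<lambda>i. a (col C i)) = col Y j"
      using mat_mult_eq_lincomb[OF C, of a] colsC xs by simp
    then show ?thesis by (intro exI[of _ "vec s (\<lambda>i. a (col C i))"]) simp
  qed
  then obtain w where w: "\<And>j. j < N \<Longrightarrow> w j \<in> carrier_vec s \<and> C *\<^sub>v w j = col Y j"
    by metis
  define D where "D = mat s N (\<lambda>(l, j). w j $ l)"
  have D: "D \<in> carrier_mat s N" by (simp add: D_def)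
  have "C * D = Y"
  proof (rule eq_matI)
    fix i j assume "i < dim_row Y" "j < dim_col Y"
    then have ij: "i < n" "j < N" using Y by auto
    have "col D j = w j" using w[OF ij(2)] ij by (intro eq_vecI) (auto simp: D_def)
    then have "(C * D) $$ (i, j) = (C *\<^sub>v w j) $ i" using ij C D by simp
    then show "(C * D) $$ (i, j) = Y $$ (i, j)" using w[OF ij(2)] ij Y by simp
  qed (use C D Y in auto)
  moreover have "x = 0\<^sub>v s" if "x \<in> carrier_vec s" "C *\<^sub>v x = 0\<^sub>v n" for x
    using lin_depI[OF C that(1) _ that(2)] li colsC xs by auto
  ultimately show thesis using that[OF R D] YR by simp
qed

text \<open>
  Padding both factors with zeros to square matrices does not change the product.
\<close>

lemma det_mult_narrow_eq_0:
  fixes P :: "'a :: field mat"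
  assumes P: "P \<in> carrier_mat p t" and Q: "Q \<in> carrier_mat t p" and "t < p"
  shows "det (P * Q) = 0"
proof -
  define P' where "P' = mat p p (\<lambda>(i, j). if j < t then P $$ (i, j) else 0)"
  define Q' where "Q' = mat p p (\<lambda>(i, j). if i < t then Q $$ (i, j) else 0)"
  have P': "P' \<in> carrier_mat p p" and Q': "Q' \<in> carrier_mat p p"
    by (simp_all add: P'_def Q'_def)
  have "P * Q = P' * Q'"
  proof (rule eq_matI)
    fix i j assume "i < dim_row (P' * Q')" "j < dim_col (P' * Q')"
    then have ij: "i < p" "j < p" using P' Q' by auto
    have "(\<Sum>l = 0..<t. P $$ (i, l) * Q $$ (l, j)) = (\<Sum>l = 0..<p. P' $$ (i, l) * Q' $$ (l, j))"
      using \<open>t < p\<close> ij by (intro sum.mono_neutral_cong_left) (auto simp: P'_def Q'_def)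
    then show "(P * Q) $$ (i, j) = (P' * Q') $$ (i, j)"
      using ij P Q P' Q' by (simp add: scalar_prod_def)
  qed (use P Q P' Q' in auto)
  moreover have "det P' = 0"
  proof -
    have "P' *\<^sub>v unit_vec p t = 0\<^sub>v p"
    proof (rule eq_vecI)
      fix i assume "i < dim_vec (0\<^sub>v p)"
      then show "(P' *\<^sub>v unit_vec p t) $ i = 0\<^sub>v p $ i"
        using \<open>t < p\<close> P' by (simp add: P'_def)
    qed (use P' in auto)
    moreover have "unit_vec p t \<noteq> (0\<^sub>v p :: 'a vec)" using \<open>t < p\<close> by simp
    ultimately show ?thesis using det_0_iff_vec_prod_zero[OF P'] unit_vec_carrier by blast
  qed
  ultimately show ?thesis using det_mult[OF P' Q'] by simp
qed

lemma det_sandwich_low_rank: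
  fixes Y :: "'a :: field mat"
  assumes Y: "Y \<in> carrier_mat n N" and "vec_space.rank n Y < p"
    and L: "L \<in> carrier_mat p n" and R: "R \<in> carrier_mat N p"
  shows "det (L * Y * R) = 0"
proof -
  define s where "s = vec_space.rank n Y"
  obtain R' D where F: "R' \<in> carrier_mat N s" "D \<in> carrier_mat s N" "Y = Y * R' * D"
    using rank_factorization[OF Y s_def] by metis
  have YR: "Y * R' \<in> carrier_mat n s" using Y F by simp
  have "L * Y * R = L * (Y * R' * D) * R" using F(3) by simp
  also have "\<dots> = (L * (Y * R')) * (D * R)"
    using assoc_mult_mat[OF L YR F(2)] assoc_mult_mat[of "L * (Y * R')" p s D N R p] L YR F(2) R
    by simp
  finally have LYR: "L * Y * R = L * (Y * R') * (D * R)" .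
  have "L * (Y * R') \<in> carrier_mat p s" "D * R \<in> carrier_mat s p"
    by (rule mult_carrier_mat[OF L YR], rule mult_carrier_mat[OF F(2) R])
  then have "det (L * (Y * R') * (D * R)) = 0"
    using assms(2) s_def by (intro det_mult_narrow_eq_0) auto
  then show ?thesis by (simp only: LYR)
qed

lemma real_scalar_prod_self_eq_0:
  assumes "v \<in> carrier_vec n" "v \<bullet> v = (0 :: real)"
  shows "v = 0\<^sub>v n"
proof -
  have "(\<Sum>i = 0..<n. v $ i * v $ i) = 0" using assms by (simp add: scalar_prod_def)
  then have "\<forall>i\<in>{0..<n}. v $ i * v $ i = 0" by (subst (asm) sum_nonneg_eq_0_iff) auto
  then show ?thesis using assms(1) by (intro eq_vecI) auto
qed

text \<open>
  Over the reals, \<open>B\<close> times its transpose and the transpose of \<open>B\<close> have the same kernel.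
\<close>

lemma gram_det_nonzero:
  fixes B :: "real mat"
  assumes B: "B \<in> carrier_mat p N"
    and inj: "\<And>x. x \<in> carrier_vec p \<Longrightarrow> B\<^sup>T *\<^sub>v x = 0\<^sub>v N \<Longrightarrow> x = 0\<^sub>v p"
  shows "det (B * B\<^sup>T) \<noteq> 0"
proof
  have BB: "B * B\<^sup>T \<in> carrier_mat p p" using B by simp
  assume "det (B * B\<^sup>T) = 0"
  then obtain x where x: "x \<in> carrier_vec p" "x \<noteq> 0\<^sub>v p" "(B * B\<^sup>T) *\<^sub>v x = 0\<^sub>v p"
    using det_0_iff_vec_prod_zero[OF BB] by auto
  have "(B\<^sup>T *\<^sub>v x) \<bullet> (B\<^sup>T *\<^sub>v x) = x \<bullet> (B *\<^sub>v (B\<^sup>T *\<^sub>v x))"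
    using transpose_vec_mult_scalar[OF B, of "B\<^sup>T *\<^sub>v x" x] B x(1)
    by (simp add: comm_scalar_prod[of _ N])
  also have "\<dots> = x \<bullet> ((B * B\<^sup>T) *\<^sub>v x)"
    using B x(1) by (simp add: assoc_mult_mat_vec[of _ p N])
  also have "\<dots> = 0" using x by simp
  finally have "B\<^sup>T *\<^sub>v x = 0\<^sub>v N"
    using B x(1) by (intro real_scalar_prod_self_eq_0) auto
  then show False using inj x by blast
qed

text \<open>
  If \<open>V * B\<close> has as many independent columns as \<open>B\<close> has rows, then the same columns of \<open>B\<close> form an
  invertible matrix, so the rows of \<open>B\<close> are independent.
\<close>

lemma full_row_rank_right_factor:
  fixes V B :: "'a :: field mat"
  assumes V: "V \<in> carrier_mat n p" and B: "B \<in> carrier_mat p N"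
    and rank: "vec_space.rank n (V * B) = p"
    and x: "x \<in> carrier_vec p" "B\<^sup>T *\<^sub>v x = 0\<^sub>v N"
  shows "x = 0\<^sub>v p"
proof -
  have VB: "V * B \<in> carrier_mat n N" using V B by simp
  obtain R where R: "R \<in> carrier_mat N p"
    and inj: "\<And>x. x \<in> carrier_vec p \<Longrightarrow> (V * B * R) *\<^sub>v x = 0\<^sub>v n \<Longrightarrow> x = 0\<^sub>v p"
    using rank_factorization[OF VB rank[symmetric]] by metis
  have BR: "B * R \<in> carrier_mat p p" using B R by simp
  have "det (B * R) \<noteq> 0"
  proof
    assume "det (B * R) = 0"
    then obtain y where y: "y \<in> carrier_vec p" "y \<noteq> 0\<^sub>v p" "(B * R) *\<^sub>v y = 0\<^sub>v p"
      using det_0_iff_vec_prod_zero[OF BR] by auto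
    have "(V * B * R) *\<^sub>v y = V *\<^sub>v ((B * R) *\<^sub>v y)"
      using assoc_mult_mat[OF V B R] assoc_mult_mat_vec[OF V BR y(1)] by simp
    moreover have "V *\<^sub>v 0\<^sub>v p = 0\<^sub>v n" using V by (intro eq_vecI) auto
    ultimately show False using inj[OF y(1)] y(2,3) by simp
  qed
  then have "det (B * R)\<^sup>T \<noteq> 0" using det_transpose[OF BR] by simp
  moreover have "(B * R)\<^sup>T *\<^sub>v x = R\<^sup>T *\<^sub>v (B\<^sup>T *\<^sub>v x)"
    using B R x(1) by (simp add: transpose_mult[OF B R] assoc_mult_mat_vec[of _ p N])
  then have "(B * R)\<^sup>T *\<^sub>v x = 0\<^sub>v p" using x R by auto
  ultimately show ?thesis
    using det_0_iff_vec_prod_zero[of "(B * R)\<^sup>T" p] BR x(1) by auto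
qed

lemma tendsto_det:
  fixes M :: "nat \<Rightarrow> real mat"
  assumes M: "\<And>m. M m \<in> carrier_mat p p" and K: "K \<in> carrier_mat p p"
    and lim: "\<And>i j. i < p \<Longrightarrow> j < p \<Longrightarrow> (\<lambda>m. M m $$ (i, j)) \<longlonglongrightarrow> K $$ (i, j)"
  shows "(\<lambda>m. det (M m)) \<longlonglongrightarrow> det K"
  unfolding det_def'[OF M] det_def'[OF K]
  by (intro tendsto_sum tendsto_mult tendsto_const tendsto_prod lim)
    (auto dest: permutes_in_image)

lemma tendsto_mult_mat:
  fixes M :: "nat \<Rightarrow> real mat"
  assumes M: "\<And>m. M m \<in> carrier_mat n N" and K: "K \<in> carrier_mat n N"
    and lim: "\<And>i j. i < n \<Longrightarrow> j < N \<Longrightarrow> (\<lambda>m. M m $$ (i, j)) \<longlonglongrightarrow> K $$ (i, j)"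
    and P: "P \<in> carrier_mat p n" and R: "R \<in> carrier_mat N q" and ij: "i < p" "j < q"
  shows "(\<lambda>m. (P * M m * R) $$ (i, j)) \<longlonglongrightarrow> (P * K * R) $$ (i, j)"
proof -
  have e: "(P * L * R) $$ (i, j) =
      (\<Sum>a = 0..<n. P $$ (i, a) * (\<Sum>b = 0..<N. L $$ (a, b) * R $$ (b, j)))"
    if "L \<in> carrier_mat n N" for L
    using that P R ij by (simp add: scalar_prod_def)
  show ?thesis
    unfolding e[OF M] e[OF K] by (intro tendsto_intros lim) auto
qed

text \<open>
  The limit \<open>v\<close> of the difference quotients \<open>E m\<close> of matrices of rank at most \<open>p\<close> maps the kernel of
  \<open>X\<close> into its column space.  Since \<open>Y m\<close> has rank at most \<open>p\<close>, every determinant of size \<open>p + 1\<close>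
  obtained from \<open>Y m\<close> by multiplication on both sides vanishes.  Border the matrix of \<open>Y m\<close> in the
  directions of \<open>V\<close> and \<open>B\<close>, which tends to the invertible Gram matrix of \<open>B\<close>, by one row from \<open>P\<close>,
  divided by \<open>t m\<close>, and one column from \<open>Q\<close>.  In the limit the border column is zero above the
  corner, so the determinant is that of the Gram matrix times the corner, which is an entry of
  \<open>P * v * Q\<close>.
\<close>

lemma low_rank_tangent_vanishes:
  fixes X v :: "real mat" and Y E :: "nat \<Rightarrow> real mat" and t :: "nat \<Rightarrow> real"
  assumes V: "V \<in> carrier_mat n p" "V\<^sup>T * V = 1\<^sub>m p" and B: "B \<in> carrier_mat p N"
    and det: "det (B * B\<^sup>T) \<noteq> 0" and X: "X = V * B"
    and E: "\<And>m. E m \<in> carrier_mat n N" and v: "v \<in> carrier_mat n N"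
    and Y: "\<And>m. Y m = X + t m \<cdot>\<^sub>m E m" and rank: "\<And>m. vec_space.rank n (Y m) \<le> p"
    and t: "\<And>m. t m > 0" "t \<longlonglongrightarrow> 0"
    and lim: "\<And>i j. i < n \<Longrightarrow> j < N \<Longrightarrow> (\<lambda>m. E m $$ (i, j)) \<longlonglongrightarrow> v $$ (i, j)"
    and P: "P \<in> carrier_mat a n" "P * V = 0\<^sub>m a p"
    and Q: "Q \<in> carrier_mat N b" "B * Q = 0\<^sub>m p b"
  shows "P * v * Q = 0\<^sub>m a b"
proof (rule eq_matI)
  fix i j assume "i < dim_row (0\<^sub>m a b)" "j < dim_col (0\<^sub>m a b)"
  then have ij: "i < a" "j < b" by auto
  have Xc: "X \<in> carrier_mat n N" using V B X by simp
  have Yc: "Y m \<in> carrier_mat n N" for m using Y Xc E by simp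
  \<comment> \<open>the smallest number of rows and columns for which the determinant has to vanish\<close>
  define L where "L m = mat (Suc p) n (\<lambda>(c, e). if c < p then V $$ (e, c) else P $$ (i, e) / t m)" for m
  define R where "R = mat N (Suc p) (\<lambda>(c, e). if e < p then B $$ (e, c) else Q $$ (c, j))"
  define K where "K = four_block_mat (B * B\<^sup>T) (0\<^sub>m p 1)
      (mat 1 p (\<lambda>(_, e). (P * v * B\<^sup>T) $$ (i, e))) (mat 1 1 (\<lambda>_. (P * v * Q) $$ (i, j)))"
  have L: "L m \<in> carrier_mat (Suc p) n" for m by (simp add: L_def)
  have R: "R \<in> carrier_mat N (Suc p)" by (simp add: R_def)
  have PX: "P * X = 0\<^sub>m a N"
    using assoc_mult_mat[OF P(1) V(1) B] B by (simp add: X P(2))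
  have VX: "V\<^sup>T * X = B"
    using assoc_mult_mat[OF transpose_carrier_mat[THEN iffD2, OF V(1)] V(1) B] B by (simp add: X V(2))
  have Ylim: "(\<lambda>m. Y m $$ (c, e)) \<longlonglongrightarrow> X $$ (c, e)" if "c < n" "e < N" for c e
  proof -
    have "(\<lambda>m. X $$ (c, e) + t m * E m $$ (c, e)) \<longlonglongrightarrow> X $$ (c, e) + 0 * v $$ (c, e)"
      using that by (intro tendsto_intros lim t(2)) auto
    moreover have "Y m $$ (c, e) = X $$ (c, e) + t m * E m $$ (c, e)" for m
      using that Xc E[of m] by (simp add: Y)
    ultimately show ?thesis by simp
  qed
  have BR: "(B * R) $$ (c, e) = (if e < p then (B * B\<^sup>T) $$ (c, e) else 0)"
    if "c < p" "e < Suc p" for c e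
  proof (cases "e < p")
    case True
    then show ?thesis using that B R by (simp add: R_def scalar_prod_def)
  next
    case False
    then have "(B * R) $$ (c, e) = (B * Q) $$ (c, j)"
      using that B R Q(1) ij by (simp add: R_def scalar_prod_def)
    moreover have "(B * Q) $$ (c, j) = 0" unfolding Q(2) using that ij by simp
    ultimately show ?thesis using False by simp
  qed
  have PR: "(M * R) $$ (i, e) =
      (if e < p then (M * B\<^sup>T) $$ (i, e) else (M * Q) $$ (i, j))"
    if "e < Suc p" "M \<in> carrier_mat a N" for e M
    using that ij B R Q by (auto simp: R_def scalar_prod_def)
  \<comment> \<open>dividing the last row by \<open>t m\<close> is harmless because \<open>P * X = 0\<close>: it turns \<open>Y m\<close> into \<open>E m\<close>\<close>
  have LR: "(L m * Y m * R) $$ (c, e) =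
      (if c < p then (V\<^sup>T * Y m * R) $$ (c, e) else (P * E m * R) $$ (i, e))"
    if c: "c < Suc p" and e: "e < Suc p" for m c e
  proof (cases "c < p")
    case True
    have "row (L m) c = row V\<^sup>T c"
      using True V by (intro eq_vecI) (auto simp: L_def)
    moreover have "(L m * Y m * R) $$ (c, e) = row (L m) c \<bullet> col (Y m * R) e"
      unfolding assoc_mult_mat[OF L Yc R] using c e L[of m] Yc[of m] R by simp
    moreover have "(V\<^sup>T * Y m * R) $$ (c, e) = row V\<^sup>T c \<bullet> col (Y m * R) e"
      unfolding assoc_mult_mat[OF transpose_carrier_mat[THEN iffD2, OF V(1)] Yc R]
      using True e V Yc[of m] R by simp
    ultimately show ?thesis using True by simp
  next
    case False
    have "row (L m * Y m) c = row (P * E m) i"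
    proof (rule eq_vecI)
      fix l assume "l < dim_vec (row (P * E m) i)"
      then have l: "l < N" using E[of m] by simp
      have PXl: "(\<Sum>f = 0..<n. P $$ (i, f) * X $$ (f, l)) = 0"
        using arg_cong[OF PX, of "\<lambda>M. M $$ (i, l)"] P Xc ij l by (simp add: scalar_prod_def)
      have "row (L m * Y m) c $ l =
          (\<Sum>f = 0..<n. P $$ (i, f) / t m * (X $$ (f, l) + t m * E m $$ (f, l)))"
        using False c l L[of m] Yc[of m] Xc E[of m] by (simp add: scalar_prod_def L_def Y)
      also have "\<dots> = (\<Sum>f = 0..<n. P $$ (i, f) * X $$ (f, l)) / t m +
          (\<Sum>f = 0..<n. P $$ (i, f) * E m $$ (f, l))"
        unfolding sum_divide_distrib sum.distrib[symmetric]
        using t(1)[of m] by (intro sum.cong refl) (simp add: field_simps)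
      also have "\<dots> = row (P * E m) i $ l"
        using PXl l ij P E[of m] by (simp add: scalar_prod_def)
      finally show "row (L m * Y m) c $ l = row (P * E m) i $ l" .
    qed (use E[of m] Yc[of m] in simp)
    moreover have "(L m * Y m * R) $$ (c, e) = row (L m * Y m) c \<bullet> col R e"
      using c e L[of m] R by (intro index_mult_mat(1)) auto
    moreover have "(P * E m * R) $$ (i, e) = row (P * E m) i \<bullet> col R e"
      using e ij P R by (intro index_mult_mat(1)) auto
    ultimately show ?thesis using False by simp
  qed
  have K: "K \<in> carrier_mat (Suc p) (Suc p)"
    using four_block_carrier_mat[of "B * B\<^sup>T" p p "mat 1 1 (\<lambda>_. (P * v * Q) $$ (i, j))" 1 1] B
    by (simp add: K_def)
  have "(\<lambda>m. (L m * Y m * R) $$ (c, e)) \<longlonglongrightarrow> K $$ (c, e)" if ce: "c < Suc p" "e < Suc p" for c e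
  proof (cases "c < p")
    case True
    have "(\<lambda>m. (V\<^sup>T * Y m * R) $$ (c, e)) \<longlonglongrightarrow> (V\<^sup>T * X * R) $$ (c, e)"
      using True ce V by (intro tendsto_mult_mat[OF Yc Xc Ylim _ R]) auto
    moreover have "(V\<^sup>T * X * R) $$ (c, e) = K $$ (c, e)"
      using True ce BR[of c e] B by (auto simp: VX K_def)
    ultimately show ?thesis using True ce LR by simp
  next
    case False
    have "(\<lambda>m. (P * E m * R) $$ (i, e)) \<longlonglongrightarrow> (P * v * R) $$ (i, e)"
      using ij ce P by (intro tendsto_mult_mat[OF E v lim _ R]) auto
    moreover have "(P * v * R) $$ (i, e) = K $$ (c, e)"
      using False ce PR[of e "P * v"] B P v by (auto simp: K_def)
    ultimately show ?thesis using False ce LR by simp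
  qed
  then have "(\<lambda>m. det (L m * Y m * R)) \<longlonglongrightarrow> det K"
    by (rule tendsto_det[OF mult_carrier_mat[OF mult_carrier_mat[OF L Yc] R] K])
  moreover have "det (L m * Y m * R) = 0" for m
    using rank[of m] by (intro det_sandwich_low_rank[OF Yc _ L R]) simp
  ultimately have "det K = 0"
    using LIMSEQ_unique[of "\<lambda>_. 0" 0 "det K"] by simp
  moreover have "det K = det (B * B\<^sup>T) * (P * v * Q) $$ (i, j)"
  proof -
    have "det (mat 1 1 (\<lambda>_. (P * v * Q) $$ (i, j))) = (P * v * Q) $$ (i, j)"
      by (subst det_single) auto
    moreover have "det K = det (B * B\<^sup>T) * det (mat 1 1 (\<lambda>_. (P * v * Q) $$ (i, j)))"
      unfolding K_def using B by (intro det_four_block_mat_upper_right_zero_col) auto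
    ultimately show ?thesis by simp
  qed
  ultimately show "(P * v * Q) $$ (i, j) = 0\<^sub>m a b $$ (i, j)"
    using det ij by simp
qed (use P Q v in auto)

section \<open>Pseudoinverses and orthogonal projections\<close>

lemma row_pinv_right_inverse:
  fixes B :: "real mat"
  assumes B: "B \<in> carrier_mat p N" and det: "det (B * B\<^sup>T) \<noteq> 0"
  shows "row_pinv B \<in> carrier_mat N p" "B * row_pinv B = 1\<^sub>m p"
    "row_pinv B * (B * B\<^sup>T) = B\<^sup>T"
proof -
  have BB: "B * B\<^sup>T \<in> carrier_mat p p" using B by simp
  have "B * B\<^sup>T \<in> Units (ring_mat TYPE(real) p ())"
    by (rule det_non_zero_imp_unit[OF BB det])
  then obtain K where K0: "mat_inverse (B * B\<^sup>T) = Some K"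
    using mat_inverse(1)[OF BB, where b = "()"] by (cases "mat_inverse (B * B\<^sup>T)") auto
  then have K: "B * B\<^sup>T * K = 1\<^sub>m p" "K * (B * B\<^sup>T) = 1\<^sub>m p" "K \<in> carrier_mat p p"
    using mat_inverse(2)[OF BB] by auto
  have e: "row_pinv B = B\<^sup>T * K" by (simp add: row_pinv_def K0)
  show "row_pinv B \<in> carrier_mat N p" using B K by (simp add: e)
  show "B * row_pinv B = 1\<^sub>m p"
    using B K by (simp add: e)
  show "row_pinv B * (B * B\<^sup>T) = B\<^sup>T"
  proof -
    have "row_pinv B * (B * B\<^sup>T) = B\<^sup>T * (K * (B * B\<^sup>T))"
      unfolding e using B K(3) BB by (intro assoc_mult_mat) auto
    then show ?thesis using B by (simp only: K(2)) simp
  qed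
qed

lemma row_pinv_mult_gram:
  fixes B C :: "real mat"
  assumes "B \<in> carrier_mat p N" "det (B * B\<^sup>T) \<noteq> 0" "C \<in> carrier_mat a N"
  shows "(C * row_pinv B * B) * B\<^sup>T = C * B\<^sup>T"
proof -
  note J = row_pinv_right_inverse[OF assms(1,2)]
  have CJ: "C * row_pinv B \<in> carrier_mat a p" using assms(3) J(1) by simp
  have "(C * row_pinv B * B) * B\<^sup>T = C * row_pinv B * (B * B\<^sup>T)"
    using CJ assms(1) by (intro assoc_mult_mat) auto
  also have "\<dots> = C * (row_pinv B * (B * B\<^sup>T))"
    using assms(1,3) J(1) by (intro assoc_mult_mat) auto
  finally show ?thesis by (simp only: J(3))
qed

lemma proj_mat_idempotent:
  assumes "S \<in> carrier_mat n p" "S\<^sup>T * S = 1\<^sub>m p"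
  shows "proj_mat S * S = S"
  using assms assoc_mult_mat[of S n p "S\<^sup>T" n S p] by (simp add: proj_mat_def)

lemma complement_projection:
  fixes P :: "real mat"
  assumes P: "P \<in> carrier_mat p p" "P\<^sup>T = P" "P * P = P"
  shows "1\<^sub>m p - P \<in> carrier_mat p p" "(1\<^sub>m p - P)\<^sup>T = 1\<^sub>m p - P"
    "(1\<^sub>m p - P) * (1\<^sub>m p - P) = 1\<^sub>m p - P" "P * (1\<^sub>m p - P) = 0\<^sub>m p p"
proof -
  show c: "1\<^sub>m p - P \<in> carrier_mat p p" by (rule minus_carrier_mat[OF P(1)])
  show "(1\<^sub>m p - P)\<^sup>T = 1\<^sub>m p - P"
    using transpose_minus[OF one_carrier_mat P(1)] P(2) by simp
  show z: "P * (1\<^sub>m p - P) = 0\<^sub>m p p"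
    using mult_minus_distrib_mat[OF P(1) one_carrier_mat P(1)] P by simp
  have "(1\<^sub>m p - P) * (1\<^sub>m p - P) = 1\<^sub>m p * (1\<^sub>m p - P) - P * (1\<^sub>m p - P)"
    using P c by (intro minus_mult_distrib_mat) auto
  also have "\<dots> = 1\<^sub>m p - P"
    unfolding z left_mult_one_mat[OF c] using P(1) by (intro eq_matI) auto
  finally show "(1\<^sub>m p - P) * (1\<^sub>m p - P) = 1\<^sub>m p - P" .
qed

lemma proj_mat_hcat:
  assumes B: "B \<in> carrier_mat n p" and C: "C \<in> carrier_mat n q"
  shows "proj_mat (hcat B C) = B * B\<^sup>T + C * C\<^sup>T"
proof (rule eq_matI)
  let ?S = "hcat B C"
  have S: "?S \<in> carrier_mat n (p + q)"
    using four_block_carrier_mat[of B n p "0\<^sub>m 0 q" 0 q] B C by (simp add: hcat_def)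
  fix i j assume "i < dim_row (B * B\<^sup>T + C * C\<^sup>T)" "j < dim_col (B * B\<^sup>T + C * C\<^sup>T)"
  then have ij: "i < n" "j < n" using C by auto
  have e: "?S $$ (a, l) = (if l < p then B $$ (a, l) else C $$ (a, l - p))"
    if "a < n" "l < p + q" for a l
    using that B C by (simp add: hcat_def)
  have "(\<Sum>l = 0..<p + q. ?S $$ (i, l) * ?S $$ (j, l)) =
      (\<Sum>l = 0..<p. B $$ (i, l) * B $$ (j, l)) + (\<Sum>l = 0..<q. C $$ (i, l) * C $$ (j, l))"
    using ij sum.shift_bounds_nat_ivl[of "\<lambda>l. C $$ (i, l - p) * C $$ (j, l - p)" 0 p q]
    by (simp add: e add.commute[of q] sum.atLeastLessThan_concat[of 0 p "p + q", symmetric])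
  then show "proj_mat ?S $$ (i, j) = (B * B\<^sup>T + C * C\<^sup>T) $$ (i, j)"
    using ij S B C by (simp add: proj_mat_def scalar_prod_def)
qed (use B C in \<open>auto simp: proj_mat_def hcat_def\<close>)

lemma proj_mat_hcat_orthonormal:
  assumes B: "B \<in> carrier_mat n p" "B\<^sup>T * B = 1\<^sub>m p"
    and C: "C \<in> carrier_mat n q" "C\<^sup>T * C = 1\<^sub>m q" and BC: "B\<^sup>T * C = 0\<^sub>m p q"
  defines "P \<equiv> proj_mat (hcat B C)"
  shows "P * B = B" "P * P = P"
proof -
  have P: "P = B * B\<^sup>T + C * C\<^sup>T" unfolding P_def by (rule proj_mat_hcat[OF B(1) C(1)])
  have Bt: "B\<^sup>T \<in> carrier_mat p n" and Ct: "C\<^sup>T \<in> carrier_mat q n" using B C by auto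
  have BB: "B * B\<^sup>T \<in> carrier_mat n n" and CC: "C * C\<^sup>T \<in> carrier_mat n n" using B C by auto
  have Pc: "P \<in> carrier_mat n n" unfolding P using BB CC by simp
  have CB: "C\<^sup>T * B = 0\<^sub>m q p"
    using transpose_mult[OF Bt C(1)] BC by simp
  have "P * B = B * B\<^sup>T * B + C * C\<^sup>T * B"
    unfolding P by (rule add_mult_distrib_mat[OF BB CC B(1)])
  also have "\<dots> = B"
    unfolding assoc_mult_mat[OF B(1) Bt B(1)] assoc_mult_mat[OF C(1) Ct B(1)] B(2) CB
    using B(1) C(1) by simp
  finally show PB: "P * B = B" .
  have "P * C = B * B\<^sup>T * C + C * C\<^sup>T * C"
    unfolding P by (rule add_mult_distrib_mat[OF BB CC C(1)])
  also have "\<dots> = C"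
    unfolding assoc_mult_mat[OF B(1) Bt C(1)] assoc_mult_mat[OF C(1) Ct C(1)] C(2) BC
    using B(1) C(1) by simp
  finally have PC: "P * C = C" .
  have "P * P = P * (B * B\<^sup>T) + P * (C * C\<^sup>T)"
    using mult_add_distrib_mat[OF Pc BB CC] unfolding P[symmetric] .
  also have "\<dots> = P * B * B\<^sup>T + P * C * C\<^sup>T"
    unfolding assoc_mult_mat[OF Pc B(1) Bt] assoc_mult_mat[OF Pc C(1) Ct] ..
  also have "\<dots> = B * B\<^sup>T + C * C\<^sup>T" by (simp only: PB PC)
  also have "\<dots> = P" by (rule P[symmetric])
  finally show "P * P = P" .
qed

lemma proj_mat_transpose: "(proj_mat S)\<^sup>T = proj_mat S"
  by (simp add: proj_mat_def transpose_mult[of S "dim_row S" "dim_col S" "S\<^sup>T" "dim_row S"])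

section \<open>Tangent cones and closest points\<close>

text \<open>
  Divide the step sizes \<open>t m\<close> by \<open>c\<close>.
\<close>

lemma tangent_cone_scale:
  assumes V: "V \<in> tangent_cone d n M X" and c: "c > 0"
  shows "(\<lambda>i. c * V i) \<in> tangent_cone d n M X"
proof -
  obtain Y :: "nat \<Rightarrow> tensor" and t :: "nat \<Rightarrow> real"
    where Y: "\<And>m. Y m \<in> M" "(\<lambda>m. frob d n (\<lambda>i. Y m i - X i)) \<longlonglongrightarrow> 0"
      and t: "\<And>m. t m > 0" "t \<longlonglongrightarrow> 0"
      and lim: "(\<lambda>m. frob d n (\<lambda>i. (Y m i - X i) / t m - V i)) \<longlonglongrightarrow> 0"
    using V unfolding tangent_cone_def by blast
  have "(\<lambda>i. (Y m i - X i) / (t m / c) - c * V i) = (\<lambda>i. c * ((Y m i - X i) / t m - V i))" for m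
    using c t(1)[of m] by (simp add: fun_eq_iff field_simps)
  then have "(\<lambda>m. frob d n (\<lambda>i. (Y m i - X i) / (t m / c) - c * V i)) =
      (\<lambda>m. \<bar>c\<bar> * frob d n (\<lambda>i. (Y m i - X i) / t m - V i))"
    by (simp only: frob_scale)
  moreover have "(\<lambda>m. \<bar>c\<bar> * frob d n (\<lambda>i. (Y m i - X i) / t m - V i)) \<longlonglongrightarrow> 0"
    using tendsto_mult[OF tendsto_const lim] by simp
  ultimately have "(\<lambda>m. frob d n (\<lambda>i. (Y m i - X i) / (t m / c) - c * V i)) \<longlonglongrightarrow> 0"
    by simp
  moreover have "(\<lambda>m. t m / c) \<longlonglongrightarrow> 0" using tendsto_divide[OF t(2) tendsto_const, of c] c by simp
  moreover have "t m / c > 0" for m using t(1)[of m] c by simp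
  moreover have "(\<lambda>i. c * V i) \<in> tensors d n"
    using V by (simp add: tangent_cone_def tensors_def)
  ultimately show ?thesis
    unfolding tangent_cone_def using Y
    by (intro CollectI conjI exI[of _ Y] exI[of _ "\<lambda>m. t m / c"] allI) assumption+
qed

text \<open>
  Shrinking \<open>P\<close> to \<open>(1 - e) * P\<close> stays in the cone and does not bring it closer to \<open>A\<close>; the first
  order term in \<open>e\<close> of the squared distance yields the inequality.
\<close>

lemma closest_point_in_cone:
  assumes cone: "\<And>V c. V \<in> T \<Longrightarrow> c > 0 \<Longrightarrow> (\<lambda>i. c * V i) \<in> T"
    and P: "closest_point_in d n T A P"
  shows "tinner d n P P \<le> tinner d n A P"
proof -
  let ?a = "tinner d n A A" and ?b = "tinner d n A P" and ?p = "tinner d n P P"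
  have dist: "(frob d n (\<lambda>i. A i - c * P i))\<^sup>2 = ?a - 2 * c * ?b + c\<^sup>2 * ?p" for c
    unfolding frob_squared
    by (simp add: tinner_diff_left tinner_diff_right tinner_scale_right
        tinner_commute[of d n "\<lambda>i. c * P i"] tinner_commute[of d n P A] power2_eq_square algebra_simps)
  have ineq: "2 * ?p - 2 * ?b \<le> e * ?p" if e: "0 < e" "e < 1" for e
  proof -
    have "(\<lambda>i. (1 - e) * P i) \<in> T"
      using P e by (intro cone) (auto simp: closest_point_in_def)
    then have "frob d n (\<lambda>i. A i - P i) \<le> frob d n (\<lambda>i. A i - (1 - e) * P i)"
      by (rule bspec[OF conjunct2[OF P[unfolded closest_point_in_def]]])
    then have "(frob d n (\<lambda>i. A i - 1 * P i))\<^sup>2 \<le> (frob d n (\<lambda>i. A i - (1 - e) * P i))\<^sup>2"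
      by (intro power_mono) (simp_all add: frob_nonneg)
    then have "e * (2 * ?p - 2 * ?b) \<le> e * (e * ?p)"
      unfolding dist by (simp add: power2_eq_square algebra_simps)
    then show ?thesis using e by simp
  qed
  have "((\<lambda>e. e * ?p) \<longlongrightarrow> 0 * ?p) (at_right 0)"
    by (intro tendsto_intros)
  moreover have "eventually (\<lambda>e. 2 * ?p - 2 * ?b \<le> e * ?p) (at_right 0)"
    unfolding eventually_at_right_field using ineq by (intro exI[of _ 1]) simp
  ultimately have "2 * ?p - 2 * ?b \<le> 0 * ?p"
    by (intro tendsto_lowerbound[of _ _ "at_right 0"]) auto
  then show ?thesis by simp
qed

section \<open>Varying one factor of a Tucker decomposition\<close>

locale tucker_point =
  fixes d :: nat and n s :: "nat \<Rightarrow> nat" and X G :: tensor and U :: "nat \<Rightarrow> real mat"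
  assumes decomposition: "tucker_decomposition d n s X G U"
begin

lemma U_carrier: "k \<in> {1..d} \<Longrightarrow> U k \<in> carrier_mat (n k) (s k)"
  and U_orthonormal: "k \<in> {1..d} \<Longrightarrow> (U k)\<^sup>T * U k = 1\<^sub>m (s k)"
  and G_tensor: "G \<in> tensors d s"
  and X_rank: "k \<in> {1..d} \<Longrightarrow> vec_space.rank (n k) (unfold_mat d n k X) = s k"
  and X_eq: "X = mode_prods {1..d} U G"
  using decomposition by (auto simp: tucker_decomposition_def stiefel_def tucker_rank_def)

text \<open>
  The tensor \<open>X\<close> with its factor in mode \<open>k\<close> replaced by \<open>Z\<close>; for \<open>Z\<close> with columns orthogonal to those
  of \<open>U k\<close> these are tangent directions at \<open>X\<close>.  With a single row in \<open>Z\<close> the same formula describes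
  a linear combination of the slices of \<open>G\<close> along mode \<open>k\<close>, expanded in the other modes.
\<close>

definition variation :: "nat \<Rightarrow> real mat \<Rightarrow> tensor" where
  "variation k Z = mode_prods ({1..d} - {k}) U (mode_prod k Z G)"

lemma X_eq_variation:
  assumes "k \<in> {1..d}"
  shows "X = variation k (U k)"
  using assms mode_prods_remove[of "{1..d}" k U G]
  by (simp add: X_eq variation_def mode_prod_mode_prods)

lemma partial_expansion_in_tensors:
  assumes "k \<in> {1..d}" "Y \<in> tensors d (s(k := p))"
  shows "mode_prods ({1..d} - {k}) U Y \<in> tensors d (n(k := p))"
proof -
  have "mode_prods ({1..d} - {k}) U Y
      \<in> tensors d (\<lambda>j. if j \<in> {1..d} - {k} then dim_row (U j) else (s(k := p)) j)"
    using U_carrier by (intro mode_prods_in_tensors[OF _ _ assms(2)]) auto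
  also have "\<dots> = tensors d (n(k := p))"
    using U_carrier by (intro tensors_cong) auto
  finally show ?thesis .
qed

lemma variation_in_tensors:
  assumes k: "k \<in> {1..d}" and Z: "Z \<in> carrier_mat p (s k)"
  shows "variation k Z \<in> tensors d (n(k := p))"
proof -
  have "mode_prod k Z G \<in> tensors d (s(k := p))"
    using mode_prod_in_tensors[OF k G_tensor, of Z] Z by simp
  then show ?thesis unfolding variation_def by (rule partial_expansion_in_tensors[OF k])
qed

lemma mode_prod_variation:
  assumes "k \<in> {1..d}" "dim_col B = dim_row Z"
  shows "mode_prod k B (variation k Z) = variation k (B * Z)"
  using assms by (simp add: variation_def mode_prod_mode_prods mode_prod_mode_prod)

lemma mode_prod_variation_other:
  assumes j: "j \<in> {1..d}" "j \<noteq> k" and B: "dim_col B = n j" "B * U j = U j"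
  shows "mode_prod j B (variation k Z) = variation k Z"
proof -
  let ?J = "{1..d} - {k}"
  let ?Y = "mode_prods (?J - {j}) U (mode_prod k Z G)"
  have "variation k Z = mode_prod j (U j) ?Y"
    unfolding variation_def using j by (intro mode_prods_remove) auto
  moreover have "mode_prod j B (mode_prod j (U j) ?Y) = mode_prod j (U j) ?Y"
    using B U_carrier[OF j(1)] by (simp add: mode_prod_mode_prod)
  ultimately show ?thesis by simp
qed

text \<open>
  The right factor in \<open>X\<^sub>(\<^sub>k\<^sub>) = U k * row_factor k\<close>: its rows span the row space of the unfolding of
  \<open>X\<close>, and every variation in mode \<open>k\<close> has its rows in the same space.
\<close>

definition row_factor :: "nat \<Rightarrow> real mat" where
  "row_factor k = unfold_mat d (n(k := s k)) k (mode_prods ({1..d} - {k}) U G)"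

lemma row_factor_carrier: "row_factor k \<in> carrier_mat (s k) (codim d n k)"
  using unfold_mat_carrier[of d "n(k := s k)" k] by (simp add: row_factor_def codim_upd)

lemma unfold_variation:
  assumes k: "k \<in> {1..d}" and Z: "Z \<in> carrier_mat p (s k)"
  shows "unfold_mat d (n(k := p)) k (variation k Z) = Z * row_factor k"
proof -
  have "variation k Z = mode_prod k Z (mode_prods ({1..d} - {k}) U G)"
    by (simp add: variation_def mode_prod_mode_prods)
  then show ?thesis
    using unfold_mat_mode_prod[OF k, of Z "n(k := s k)"] Z by (simp add: row_factor_def)
qed

lemma row_factor_gram: 
  assumes k: "k \<in> {1..d}"
  shows "det (row_factor k * (row_factor k)\<^sup>T) \<noteq> 0"
proof (rule gram_det_nonzero[OF row_factor_carrier])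
  fix x :: "real vec"
  assume x: "x \<in> carrier_vec (s k)" "(row_factor k)\<^sup>T *\<^sub>v x = 0\<^sub>v (codim d n k)"
  have "unfold_mat d n k X = U k * row_factor k"
    using unfold_variation[OF k U_carrier[OF k]] X_eq_variation[OF k] by simp
  then have "vec_space.rank (n k) (U k * row_factor k) = s k"
    using X_rank[OF k] by simp
  from full_row_rank_right_factor[OF U_carrier[OF k] row_factor_carrier this x]
  show "x = 0\<^sub>v (s k)" .
qed

text \<open>
  A linear relation between the rows of the unfolded core \<open>G\<close> is a matrix \<open>Z\<close> with one row and
  \<open>variation k Z = 0\<close>, hence a relation between the rows of \<open>row_factor k\<close>, which are independent.
\<close>

lemma core_gram:
  assumes k: "k \<in> {1..d}"
  shows "det (unfold_mat d s k G * (unfold_mat d s k G)\<^sup>T) \<noteq> 0"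
proof (rule gram_det_nonzero[OF unfold_mat_carrier])
  let ?g = "unfold_mat d s k G"
  fix x :: "real vec"
  assume x: "x \<in> carrier_vec (s k)" "?g\<^sup>T *\<^sub>v x = 0\<^sub>v (codim d s k)"
  define Z where "Z = mat 1 (s k) (\<lambda>(_, j). x $ j)"
  have Z: "Z \<in> carrier_mat 1 (s k)" by (simp add: Z_def)
  have zero: "Z * B = 0\<^sub>m 1 N \<longleftrightarrow> B\<^sup>T *\<^sub>v x = 0\<^sub>v N" if B: "B \<in> carrier_mat (s k) N" for B N
  proof -
    have e: "(Z * B) $$ (0, j) = (B\<^sup>T *\<^sub>v x) $ j" if "j < N" for j
      using that x B by (simp add: Z_def scalar_prod_def mult.commute)
    show ?thesis
    proof
      assume a: "Z * B = 0\<^sub>m 1 N"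
      show "B\<^sup>T *\<^sub>v x = 0\<^sub>v N"
        using B e[symmetric] by (intro eq_vecI) (auto simp: a simp del: index_mult_mat_vec)
    next
      assume a: "B\<^sup>T *\<^sub>v x = 0\<^sub>v N"
      show "Z * B = 0\<^sub>m 1 N"
        using B Z e by (intro eq_matI) (auto simp: a simp del: index_mult_mat(1))
    qed
  qed
  have zt: "(\<lambda>_. 0) \<in> tensors d m" for m by (simp add: tensors_def)
  have uz: "unfold_mat d m k (\<lambda>_. 0) = 0\<^sub>m (m k) (codim d m k)" for m
    by (rule eq_matI) (simp_all add: unfold_mat_def)
  have ZG: "mode_prod k Z G \<in> tensors d (s(k := 1))"
    using mode_prod_in_tensors[OF k G_tensor, of Z] Z by simp
  have "unfold_mat d (s(k := 1)) k (mode_prod k Z G) = Z * ?g"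
    using unfold_mat_mode_prod[OF k, of Z s G] Z by simp
  also have "\<dots> = 0\<^sub>m 1 (codim d s k)"
    using zero[of ?g "codim d s k"] x(2) by simp
  finally have "mode_prod k Z G = (\<lambda>_. 0)"
    by (intro unfold_mat_inject[OF k ZG zt]) (simp add: uz codim_upd)
  then have "variation k Z = (\<lambda>_. 0)"
    by (simp add: variation_def mode_prods_zero_tensor)
  then have "Z * row_factor k = 0\<^sub>m 1 (codim d n k)"
    using unfold_variation[OF k Z] by (simp add: uz codim_upd)
  then have "(row_factor k)\<^sup>T *\<^sub>v x = 0\<^sub>v (codim d n k)"
    using zero[OF row_factor_carrier] by simp
  moreover have "vec_space.rank (n k) (U k * row_factor k) = s k"
    using X_rank[OF k] unfold_variation[OF k U_carrier[OF k]] X_eq_variation[OF k] by simp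
  ultimately show "x = 0\<^sub>v (s k)"
    using full_row_rank_right_factor[OF U_carrier[OF k] row_factor_carrier] x(1) by blast
qed

text \<open>
  The least squares solution: among the matrices \<open>Z\<close> with \<open>P * Z = Z\<close>, for an orthogonal projector \<open>P\<close>,
  this one makes \<open>variation k Z\<close> closest to \<open>A\<close>.
\<close>

definition best_variation :: "nat \<Rightarrow> real mat \<Rightarrow> tensor \<Rightarrow> real mat" where
  "best_variation k P A =
     P * unfold_mat d (s(k := n k)) k (mode_prods ({1..d} - {k}) (\<lambda>j. (U j)\<^sup>T) A) *
     row_pinv (unfold_mat d s k G)"

lemma best_variation_carrier:
  assumes k: "k \<in> {1..d}" and P: "P \<in> carrier_mat p (n k)"
  shows "best_variation k P A \<in> carrier_mat p (s k)"
proof -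
  have "unfold_mat d (s(k := n k)) k Y \<in> carrier_mat (n k) (codim d s k)" for Y
    using unfold_mat_carrier[of d "s(k := n k)" k Y] by (simp add: codim_upd)
  then show ?thesis
    unfolding best_variation_def
    by (rule mult_carrier_mat[OF mult_carrier_mat[OF P]
          row_pinv_right_inverse(1)[OF unfold_mat_carrier core_gram[OF k]]])
qed

text \<open>
  The normal equations of this least squares problem: \<open>A\<close> and its best variation differ by a tensor
  orthogonal to all variations with \<open>P * Z = Z\<close>.  Contracting the other modes with the transposed
  factors reduces the claim to the unfolded core \<open>g\<close>, where it says that \<open>P b g\<^sup>T\<close> is unchanged when
  \<open>b\<close> is multiplied on the right by the projector (pseudoinverse of \<open>g\<close>) times \<open>g\<close>.
\<close>

lemma tinner_variation:
  assumes k: "k \<in> {1..d}" and A: "A \<in> tensors d n"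
    and P: "P \<in> carrier_mat (n k) (n k)" "P\<^sup>T = P" "P * P = P"
    and Z: "Z \<in> carrier_mat (n k) (s k)" "P * Z = Z"
  shows "tinner d n A (variation k Z) =
    tinner d n (variation k (best_variation k P A)) (variation k Z)"
proof -
  let ?J = "{1..d} - {k}"
  let ?R = "mode_prods ?J (\<lambda>j. (U j)\<^sup>T)"
  let ?m = "s(k := n k)"
  let ?g = "unfold_mat d s k G"
  define b where "b = unfold_mat d ?m k (?R A)"
  define W where "W = best_variation k P A"
  have g: "?g \<in> carrier_mat (s k) (codim d s k)" by simp
  have b: "b \<in> carrier_mat (n k) (codim d s k)"
    using unfold_mat_carrier[of d ?m k "?R A"] by (simp add: b_def codim_upd)
  have W: "W \<in> carrier_mat (n k) (s k)"
    unfolding W_def by (rule best_variation_carrier[OF k P(1)])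
  have Weq: "W = P * b * row_pinv ?g" by (simp add: W_def best_variation_def b_def)
  have R: "tinner d n Y (variation k Z) = tinner d ?m (?R Y) (mode_prod k Z G)" for Y
    unfolding variation_def using U_carrier by (intro tinner_mode_prods) auto
  have unf: "unfold_mat d ?m k (mode_prod k V G) = V * ?g" if "V \<in> carrier_mat (n k) (s k)" for V
    using unfold_mat_mode_prod[OF k, of V s G] that by simp
  \<comment> \<open>\<open>A\<close> may be replaced by \<open>mode_prod k P A\<close>, as \<open>P\<close> is symmetric and fixes \<open>variation k Z\<close>\<close>
  have RP: "unfold_mat d ?m k (?R (mode_prod k P A)) = P * b"
  proof -
    have "?R (mode_prod k P A) = mode_prod k P (?R A)"
      by (simp add: mode_prod_mode_prods)
    then show ?thesis
      using unfold_mat_mode_prod[OF k, of P ?m "?R A"] P by (simp add: b_def)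
  qed
  have RW: "?R (variation k W) = mode_prod k W G"
  proof -
    have t: "mode_prod k W G \<in> tensors d ?m"
      using mode_prod_in_tensors[OF k G_tensor, of W] W by simp
    have "?R (variation k W) = mode_prods ?J (\<lambda>j. (U j)\<^sup>T * U j) (mode_prod k W G)"
      unfolding variation_def by (rule mode_prods_mode_prods) (use U_carrier in auto)
    also have "\<dots> = mode_prod k W G"
      by (rule mode_prods_one[OF _ _ t]) (use U_orthonormal in auto)
    finally show ?thesis .
  qed
  have "(P * b - W * ?g) * (Z * ?g)\<^sup>T = 0\<^sub>m (n k) (n k)"
  proof -
    have c: "P * b \<in> carrier_mat (n k) (codim d s k)" "W * ?g \<in> carrier_mat (n k) (codim d s k)"
      using P b W by auto
    have "(P * b - W * ?g) * ?g\<^sup>T = P * b * ?g\<^sup>T - W * ?g * ?g\<^sup>T"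
      using c g by (intro minus_mult_distrib_mat[of _ "n k" "codim d s k" _ _ "s k"]) auto
    also have "W * ?g * ?g\<^sup>T = P * b * ?g\<^sup>T"
      unfolding Weq by (rule row_pinv_mult_gram[OF g core_gram[OF k] c(1)])
    finally have z: "(P * b - W * ?g) * ?g\<^sup>T = 0\<^sub>m (n k) (s k)"
      using minus_r_inv_mat[of "P * b * ?g\<^sup>T" "n k" "s k"] c(1) g by simp
    have "(P * b - W * ?g) * (?g\<^sup>T * Z\<^sup>T) = (P * b - W * ?g) * ?g\<^sup>T * Z\<^sup>T"
      using c Z g by (intro assoc_mult_mat[symmetric]) auto
    also have "\<dots> = 0\<^sub>m (n k) (n k)" unfolding z using Z by simp
    finally show ?thesis by (simp add: transpose_mult[OF Z(1) g])
  qed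
  then have "tinner d ?m (\<lambda>i. ?R (mode_prod k P A) i - mode_prod k W G i) (mode_prod k Z G) = 0"
    unfolding tinner_eq_trace[OF k] unfold_mat_diff RP unf[OF W] unf[OF Z(1)] by simp
  then have "tinner d n (mode_prod k P A) (variation k Z) = tinner d n (variation k W) (variation k Z)"
    unfolding tinner_diff_left R RW by simp
  moreover have "tinner d n (mode_prod k P A) (variation k Z) = tinner d n A (variation k Z)"
    using tinner_mode_prod[OF k, of P "n k" n A "variation k Z"] P Z mode_prod_variation[OF k, of P Z]
    by simp
  ultimately show ?thesis by (simp add: W_def)
qed

text \<open>
  In a mode where \<open>X\<close> has the maximal rank, the unfoldings of the approximating tensors have no more
  rank than that of \<open>X\<close>.  So the unfolding of \<open>V\<close>, after multiplication by \<open>P\<close>, vanishes on the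
  kernel of \<open>row_factor k\<close>; hence it factors through \<open>row_factor k\<close>, which makes it the unfolding of a
  variation.
\<close>

lemma tangent_full_rank_mode:
  assumes k: "k \<in> {1..d}" and s: "s k = r k"
    and V: "V \<in> tangent_cone d n (tucker_variety d n r) X"
    and P: "P \<in> carrier_mat (n k) (n k)" "P * P = P" "P * U k = 0\<^sub>m (n k) (s k)"
  obtains Z where "Z \<in> carrier_mat (n k) (s k)" "P * Z = Z" "mode_prod k P V = variation k Z"
proof -
  let ?N = "codim d n k"
  let ?h = "row_factor k"
  let ?v = "unfold_mat d n k V"
  have Vt: "V \<in> tensors d n" using V by (simp add: tangent_cone_def)
  obtain Y :: "nat \<Rightarrow> tensor" and t :: "nat \<Rightarrow> real"
    where Y: "\<And>m. Y m \<in> tucker_variety d n r" and t: "\<And>m. t m > 0" "t \<longlonglongrightarrow> 0"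
      and lim: "(\<lambda>m. frob d n (\<lambda>i. (Y m i - X i) / t m - V i)) \<longlonglongrightarrow> 0"
    using V unfolding tangent_cone_def by blast
  define E where "E m = unfold_mat d n k (\<lambda>i. (Y m i - X i) / t m)" for m
  note h = row_factor_carrier[of k] and J = row_pinv_right_inverse[OF row_factor_carrier row_factor_gram[OF k]]
  define K where "K = row_pinv ?h"
  have K: "K \<in> carrier_mat ?N (s k)" "?h * K = 1\<^sub>m (s k)" using J by (simp_all add: K_def)
  have X: "unfold_mat d n k X = U k * ?h"
    using unfold_variation[OF k U_carrier[OF k]] X_eq_variation[OF k] by simp
  have KQ: "1\<^sub>m ?N - K * ?h \<in> carrier_mat ?N ?N" using K h by auto
  \<comment> \<open>\<open>1 - K * ?h\<close> is the orthogonal projector onto the kernel of \<open>row_factor k\<close>\<close>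
  have hQ: "?h * (1\<^sub>m ?N - K * ?h) = 0\<^sub>m (s k) ?N"
  proof -
    have "?h * (1\<^sub>m ?N - K * ?h) = ?h * 1\<^sub>m ?N - ?h * (K * ?h)"
      using h K by (intro mult_minus_distrib_mat) auto
    also have "?h * (K * ?h) = ?h * K * ?h"
      using h K by (intro assoc_mult_mat[symmetric]) auto
    finally show ?thesis using h by (simp only: K(2)) simp
  qed
  have "P * ?v * (1\<^sub>m ?N - K * ?h) = 0\<^sub>m (n k) ?N"
  proof (rule low_rank_tangent_vanishes[OF U_carrier[OF k] U_orthonormal[OF k] h
        row_factor_gram[OF k] X _ unfold_mat_carrier _ _ t _ P(1,3) KQ hQ])
    show "E m \<in> carrier_mat (n k) ?N" for m by (simp add: E_def)
    show "unfold_mat d n k (Y m) = unfold_mat d n k X + t m \<cdot>\<^sub>m E m" for m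
      using t(1)[of m] by (intro eq_matI) (auto simp: E_def unfold_mat_def)
    show "vec_space.rank (n k) (unfold_mat d n k (Y m)) \<le> s k" for m
      using Y[of m] k s by (simp add: tucker_variety_def tucker_rank_def)
    show "(\<lambda>m. E m $$ (i, j)) \<longlonglongrightarrow> ?v $$ (i, j)" if ij: "i < n k" "j < ?N" for i j
    proof -
      let ?f = "fiber_index d n k i j"
      have f: "?f \<in> tensor_indices d n"
        using bij_betw_fiber_index[OF k, of n] ij by (auto simp: bij_betw_def)
      have "(\<lambda>m. (Y m ?f - X ?f) / t m - V ?f) \<longlonglongrightarrow> 0"
      proof (rule tendsto_0_le[OF lim, of _ 1], intro always_eventually allI)
        show "norm ((Y m ?f - X ?f) / t m - V ?f)
            \<le> norm (frob d n (\<lambda>i. (Y m i - X i) / t m - V i)) * 1" for m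
          using abs_le_frob[OF f, of "\<lambda>i. (Y m i - X i) / t m - V i"] by (simp add: frob_nonneg)
      qed
      then have "(\<lambda>m. (Y m ?f - X ?f) / t m) \<longlonglongrightarrow> V ?f"
        by (rule LIM_zero_cancel)
      then show ?thesis using ij by (simp add: E_def unfold_mat_def)
    qed
  qed
  moreover have "P * ?v * (1\<^sub>m ?N - K * ?h) = P * ?v - P * ?v * (K * ?h)"
    using mult_minus_distrib_mat[of "P * ?v" "n k" ?N "1\<^sub>m ?N" ?N "K * ?h"] P(1) h K(1)
      right_mult_one_mat[of "P * ?v" "n k" ?N] by simp
  ultimately have z: "P * ?v - P * ?v * (K * ?h) = 0\<^sub>m (n k) ?N" by simp
  have c: "P * ?v \<in> carrier_mat (n k) ?N" "P * ?v * (K * ?h) \<in> carrier_mat (n k) ?N"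
    using P h K by auto
  have Pv: "P * ?v = P * ?v * (K * ?h)"
  proof (rule eq_matI)
    fix i j assume "i < dim_row (P * ?v * (K * ?h))" "j < dim_col (P * ?v * (K * ?h))"
    then have ij: "i < n k" "j < ?N" using c(2) by (metis carrier_matD)+
    have "(P * ?v - P * ?v * (K * ?h)) $$ (i, j) = (P * ?v) $$ (i, j) - (P * ?v * (K * ?h)) $$ (i, j)"
      using ij c by (intro index_minus_mat) auto
    then show "(P * ?v) $$ (i, j) = (P * ?v * (K * ?h)) $$ (i, j)"
      unfolding z using ij by simp
  qed (use P h in \<open>auto simp: unfold_mat_def\<close>)
  define Z where "Z = P * ?v * K"
  have Z: "Z \<in> carrier_mat (n k) (s k)"
    unfolding Z_def by (rule mult_carrier_mat[OF c(1) K(1)])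
  show thesis
  proof (rule that[OF Z])
    have "P * (P * ?v * K) = P * (P * ?v) * K"
      by (rule assoc_mult_mat[OF P(1) c(1) K(1), symmetric])
    also have "P * (P * ?v) = P * P * ?v"
      using assoc_mult_mat[OF P(1) P(1), of ?v ?N] by simp
    finally show "P * Z = Z" unfolding Z_def by (simp only: P(2))
    show "mode_prod k P V = variation k Z"
    proof (rule unfold_mat_inject[OF k])
      show "mode_prod k P V \<in> tensors d n"
        using mode_prod_in_tensors[OF k Vt, of P] P by simp
      show "variation k Z \<in> tensors d n"
        using variation_in_tensors[OF k Z] by simp
      have "unfold_mat d n k (mode_prod k P V) = P * ?v"
        using unfold_mat_mode_prod[OF k, of P n V] P by simp
      also have "\<dots> = P * ?v * (K * ?h)" by (rule Pv)
      also have "\<dots> = Z * ?h"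
        unfolding Z_def by (rule assoc_mult_mat[OF c(1) K(1) h, symmetric])
      also have "\<dots> = unfold_mat d n k (variation k Z)"
        using unfold_variation[OF k Z] by simp
      finally show "unfold_mat d n k (mode_prod k P V) = unfold_mat d n k (variation k Z)" .
    qed
  qed
qed

end

section \<open>Projecting with enlarged factor spaces\<close>

text \<open>
  \<open>P k\<close> is the orthogonal projector onto a space that contains the columns of \<open>U k\<close>.
\<close>

locale enlarged_tucker_point = tucker_point +
  fixes P :: "nat \<Rightarrow> real mat"
  assumes P_carrier: "k \<in> {1..d} \<Longrightarrow> P k \<in> carrier_mat (n k) (n k)"
    and P_sym: "k \<in> {1..d} \<Longrightarrow> (P k)\<^sup>T = P k"
    and P_idem: "k \<in> {1..d} \<Longrightarrow> P k * P k = P k"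
    and P_U: "k \<in> {1..d} \<Longrightarrow> P k * U k = U k"
begin

definition core_part :: "tensor \<Rightarrow> tensor" where
  "core_part A = mode_prods {1..d} P A"

definition mode_part :: "nat \<Rightarrow> tensor \<Rightarrow> tensor" where
  "mode_part k A = variation k (best_variation k (1\<^sub>m (n k) - P k) A)"

definition projection :: "tensor \<Rightarrow> tensor" where
  "projection A = (\<lambda>i. core_part A i + (\<Sum>k\<in>{1..d}. mode_part k A i))"

lemmas perp = complement_projection[OF P_carrier P_sym P_idem]

lemma perp_U:
  assumes "k \<in> {1..d}"
  shows "(1\<^sub>m (n k) - P k) * U k = 0\<^sub>m (n k) (s k)"
  unfolding minus_mult_distrib_mat[OF one_carrier_mat P_carrier[OF assms] U_carrier[OF assms]]
    P_U[OF assms] left_mult_one_mat[OF U_carrier[OF assms]]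
  by (rule minus_r_inv_mat[OF U_carrier[OF assms]])

lemma perp_best_variation:
  assumes k: "k \<in> {1..d}"
  shows "(1\<^sub>m (n k) - P k) * best_variation k (1\<^sub>m (n k) - P k) A =
      best_variation k (1\<^sub>m (n k) - P k) A"
    and "P k * best_variation k (1\<^sub>m (n k) - P k) A = 0\<^sub>m (n k) (s k)"
proof -
  let ?Q = "1\<^sub>m (n k) - P k"
  let ?b = "unfold_mat d (s(k := n k)) k (mode_prods ({1..d} - {k}) (\<lambda>j. (U j)\<^sup>T) A)"
  let ?J = "row_pinv (unfold_mat d s k G)"
  have Q: "?Q \<in> carrier_mat (n k) (n k)" using perp(1)[OF k k k] .
  have b: "?b \<in> carrier_mat (n k) (codim d s k)"
    using unfold_mat_carrier[of d "s(k := n k)" k] by (simp add: codim_upd)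
  have J: "?J \<in> carrier_mat (codim d s k) (s k)"
    by (rule row_pinv_right_inverse(1)[OF unfold_mat_carrier core_gram[OF k]])
  have e: "R * best_variation k ?Q A = R * ?Q * ?b * ?J" if R: "R \<in> carrier_mat (n k) (n k)" for R
    unfolding best_variation_def
    using assoc_mult_mat[OF R mult_carrier_mat[OF Q b] J] assoc_mult_mat[OF R Q b] by simp
  show "?Q * best_variation k ?Q A = best_variation k ?Q A"
    unfolding e[OF Q] perp(3)[OF k k k] by (simp add: best_variation_def)
  have "0\<^sub>m (n k) (n k) * ?b * ?J = 0\<^sub>m (n k) (s k)"
    using b J by simp
  then show "P k * best_variation k ?Q A = 0\<^sub>m (n k) (s k)"
    unfolding e[OF P_carrier[OF k]] perp(4)[OF k k k] .
qed

lemma variation_zero: "variation k (0\<^sub>m p q) = (\<lambda>i. 0)"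
  by (simp add: variation_def mode_prod_zero_mat mode_prods_zero_tensor)

lemma P_mode_part:
  assumes k: "k \<in> {1..d}"
  shows "mode_prod k (P k) (mode_part k A) = (\<lambda>i. 0)"
proof -
  have "best_variation k (1\<^sub>m (n k) - P k) A \<in> carrier_mat (n k) (s k)"
    by (rule best_variation_carrier[OF k perp(1)[OF k k k]])
  then have "mode_prod k (P k) (mode_part k A) =
      variation k (P k * best_variation k (1\<^sub>m (n k) - P k) A)"
    unfolding mode_part_def using k P_carrier[OF k] by (intro mode_prod_variation) auto
  then show ?thesis by (simp only: perp_best_variation(2)[OF k] variation_zero)
qed

lemma P_mode_part_other:
  assumes "j \<in> {1..d}" "j \<noteq> k"
  shows "mode_prod j (P j) (mode_part k A) = mode_part k A"
  unfolding mode_part_def using assms P_carrier[OF assms(1)] P_U[OF assms(1)]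
  by (intro mode_prod_variation_other) auto

lemma P_mode_prods:
  assumes "finite J" "k \<in> J" "J \<subseteq> {1..d}"
  shows "mode_prod k (P k) (mode_prods J P A) = mode_prods J P A"
  using assms P_carrier[of k] P_idem[of k]
  by (auto simp: mode_prods_remove[of J k] mode_prod_mode_prod)

lemma tinner_mode_prods_P:
  assumes "J \<subseteq> {1..d}"
  shows "tinner d n Y (mode_prods J P Z) = tinner d n (mode_prods J P Y) Z"
proof -
  have J: "finite J" using assms finite_subset by blast
  have "tinner d n Y (mode_prods J P Z) = tinner d n (mode_prods J (\<lambda>k. (P k)\<^sup>T) Y) Z"
    using assms J P_carrier by (intro tinner_mode_prods) auto
  also have "mode_prods J (\<lambda>k. (P k)\<^sup>T) Y = mode_prods J P Y"
    using assms J P_sym by (intro mode_prods_cong) auto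
  finally show ?thesis .
qed

lemma mode_prods_P_orthogonal_mode_part:
  assumes "J \<subseteq> {1..d}" "k \<in> J"
  shows "tinner d n (mode_prods J P A) (mode_part k B) = 0"
proof -
  have k: "k \<in> {1..d}" and J: "finite J" using assms finite_subset by auto
  show ?thesis
    by (rule tinner_eq_0_if_fixed_killed[where n = n, OF k P_carrier[OF k] P_sym[OF k]
        P_mode_prods[OF J assms(2,1)] P_mode_part[OF k]])
qed

lemma mode_parts_orthogonal:
  assumes "k \<in> {1..d}" "l \<in> {1..d}" "k \<noteq> l"
  shows "tinner d n (mode_part k A) (mode_part l B) = 0"
  by (rule tinner_eq_0_if_fixed_killed[where n = n, OF assms(2) P_carrier[OF assms(2)]
        P_sym[OF assms(2)] P_mode_part_other[OF assms(2) assms(3)[symmetric]]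
        P_mode_part[OF assms(2)]])

lemma tinner_core_part: "tinner d n A (core_part A) = tinner d n (core_part A) (core_part A)"
proof -
  have "mode_prods {1..d} P (core_part A) = mode_prods {1..d} (\<lambda>k. P k * P k) A"
    unfolding core_part_def
    by (rule mode_prods_mode_prods) (simp_all add: carrier_matD[OF P_carrier])
  also have "\<dots> = core_part A"
    unfolding core_part_def using P_idem by (intro mode_prods_cong) auto
  finally show ?thesis
    using tinner_mode_prods_P[of "{1..d}" A "core_part A"] by (simp add: core_part_def)
qed

lemma tinner_mode_part_variation:
  assumes "k \<in> {1..d}" "A \<in> tensors d n" "Z \<in> carrier_mat (n k) (s k)" "(1\<^sub>m (n k) - P k) * Z = Z"
  shows "tinner d n A (variation k Z) = tinner d n (mode_part k A) (variation k Z)"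
  unfolding mode_part_def
  by (rule tinner_variation[OF assms(1,2) perp(1-3)[OF assms(1,1,1)] assms(3,4)])

lemma tinner_mode_part:
  assumes k: "k \<in> {1..d}" and A: "A \<in> tensors d n"
  shows "tinner d n A (mode_part k A) = tinner d n (mode_part k A) (mode_part k A)"
  by (rule tinner_mode_part_variation[OF k A best_variation_carrier[OF k perp(1)[OF k k k]]
        perp_best_variation(1)[OF k], of A, folded mode_part_def])

lemma tinner_projection_self:
  "tinner d n (projection A) (projection A) =
    tinner d n (core_part A) (core_part A) + (\<Sum>k\<in>{1..d}. tinner d n (mode_part k A) (mode_part k A))"
  unfolding projection_def
proof (rule tinner_orthogonal_sum[of "{1..d}" d n "core_part A" "\<lambda>k. mode_part k A"])
  show "tinner d n (core_part A) (mode_part k A) = 0" if "k \<in> {1..d}" for k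
    unfolding core_part_def by (rule mode_prods_P_orthogonal_mode_part[OF subset_refl that])
qed (rule finite_atLeastAtMost, rule mode_parts_orthogonal)

lemma tinner_projection:
  assumes "A \<in> tensors d n"
  shows "tinner d n A (projection A) = tinner d n (projection A) (projection A)"
proof -
  have "(\<Sum>k\<in>{1..d}. tinner d n A (mode_part k A)) =
      (\<Sum>k\<in>{1..d}. tinner d n (mode_part k A) (mode_part k A))"
    by (rule sum.cong[OF refl tinner_mode_part[OF _ assms]])
  then show ?thesis
    unfolding tinner_projection_self
    unfolding projection_def tinner_add_right tinner_sum_right tinner_core_part[of A] by simp
qed

text \<open>
  For \<open>k \<in> J\<close> the complementary component of \<open>V\<close> in mode \<open>k\<close> is a variation in that mode, so the
  projectors of all other modes leave it unchanged.  Therefore multiplying by one more \<open>P k\<close> subtracts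
  exactly one component.
\<close>

lemma tangent_vector_decomposition:
  assumes J: "J \<subseteq> {1..d}" "\<And>k. k \<in> J \<Longrightarrow> s k = r k"
    and V: "V \<in> tangent_cone d n (tucker_variety d n r) X"
  shows "mode_prods J P V = (\<lambda>i. V i - (\<Sum>k\<in>J. mode_prod k (1\<^sub>m (n k) - P k) V i))"
proof -
  have Vt: "V \<in> tensors d n" using V by (simp add: tangent_cone_def)
  have "finite J" using J(1) finite_subset by blast
  then show ?thesis
    using J
  proof (induction J rule: finite_induct)
    case (insert k J)
    let ?V = "\<lambda>j. mode_prod j (1\<^sub>m (n j) - P j) V"
    have k: "k \<in> {1..d}" using insert.prems by simp
    have fixed: "mode_prod k (P k) (?V j) = ?V j" if j: "j \<in> J" for j
    proof -
      have j': "j \<in> {1..d}" "s j = r j" "k \<noteq> j" using insert.prems insert.hyps j by auto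
      obtain Z where "?V j = variation j Z"
        by (rule tangent_full_rank_mode[OF j'(1,2) V perp(1,3)[OF j'(1,1,1)] perp_U[OF j'(1)]])
      then show ?thesis
        using mode_prod_variation_other[OF k j'(3), of "P k"] P_carrier[OF k] P_U[OF k] by simp
    qed
    have Vk: "mode_prod k (P k) V = (\<lambda>i. V i - ?V k i)"
      using mode_prod_minus_mat[OF one_carrier_mat P_carrier[OF k], of k V]
        mode_prod_one[OF k Vt] by simp
    have IH: "mode_prods J P V = (\<lambda>i. V i - (\<Sum>j\<in>J. ?V j i))"
      using insert.prems by (intro insert.IH) auto
    have "mode_prods (insert k J) P V = mode_prod k (P k) (\<lambda>i. V i - (\<Sum>j\<in>J. ?V j i))"
      unfolding mode_prods_insert[OF insert.hyps] IH ..
    also have "\<dots> = (\<lambda>i. V i - ?V k i - (\<Sum>j\<in>J. mode_prod k (P k) (?V j) i))"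
      unfolding mode_prod_diff mode_prod_sum Vk ..
    also have "\<dots> = (\<lambda>i. V i - ?V k i - (\<Sum>j\<in>J. ?V j i))"
      using fixed by simp
    finally show ?case using insert.hyps by (simp add: diff_diff_eq)
  qed simp
qed

text \<open>
  The projectors are symmetric, so each component of the tangent vector can be exchanged for the
  corresponding component of \<open>A\<close>; for the components that are variations this uses that the mode part
  is a best approximation.
\<close>

lemma tinner_tangent:
  assumes J: "J \<subseteq> {1..d}" "\<And>k. k \<in> J \<Longrightarrow> s k = r k"
    and V: "V \<in> tangent_cone d n (tucker_variety d n r) X" and A: "A \<in> tensors d n"
  shows "tinner d n A V =
    tinner d n (\<lambda>i. mode_prods J P A i + (\<Sum>k\<in>J. mode_part k A i)) V"
proof -
  let ?V = "\<lambda>k. mode_prod k (1\<^sub>m (n k) - P k) V"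
  have "tinner d n A (?V k) = tinner d n (mode_part k A) V" if kJ: "k \<in> J" for k
  proof -
    have k: "k \<in> {1..d}" "s k = r k" using J kJ by auto
    note Q = perp[OF k(1,1,1)]
    obtain Z where Z: "Z \<in> carrier_mat (n k) (s k)" "(1\<^sub>m (n k) - P k) * Z = Z" "?V k = variation k Z"
      by (rule tangent_full_rank_mode[OF k V Q(1,3) perp_U[OF k(1)]])
    have "tinner d n A (?V k) = tinner d n (mode_part k A) (?V k)"
      unfolding Z(3) by (rule tinner_mode_part_variation[OF k(1) A Z(1,2)])
    also have "\<dots> = tinner d n (mode_prod k (1\<^sub>m (n k) - P k) (mode_part k A)) V"
      using tinner_mode_prod[where n = n, OF k(1) Q(1), of "mode_part k A" V] Q(2) by simp
    also have "mode_prod k (1\<^sub>m (n k) - P k) (mode_part k A) = mode_part k A"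
    proof -
      have "best_variation k (1\<^sub>m (n k) - P k) A \<in> carrier_mat (n k) (s k)"
        by (rule best_variation_carrier[OF k(1) Q(1)])
      then have "mode_prod k (1\<^sub>m (n k) - P k) (mode_part k A) =
          variation k ((1\<^sub>m (n k) - P k) * best_variation k (1\<^sub>m (n k) - P k) A)"
        unfolding mode_part_def using P_carrier[OF k(1)] by (intro mode_prod_variation[OF k(1)]) simp
      then show ?thesis by (simp only: perp_best_variation(1)[OF k(1)] mode_part_def)
    qed
    finally show ?thesis .
  qed
  then have "(\<Sum>k\<in>J. tinner d n A (?V k)) = (\<Sum>k\<in>J. tinner d n (mode_part k A) V)"
    by (rule sum.cong[OF refl])
  moreover have "tinner d n (mode_prods J P A) V = tinner d n A V - (\<Sum>k\<in>J. tinner d n A (?V k))"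
  proof -
    have V_eq: "mode_prods J P V = (\<lambda>i. V i - (\<Sum>k\<in>J. ?V k i))"
      by (rule tangent_vector_decomposition[OF J V])
    show ?thesis
      unfolding tinner_mode_prods_P[OF J(1), symmetric] V_eq
      by (simp add: tinner_diff_right tinner_sum_right)
  qed
  ultimately show ?thesis by (simp add: tinner_add_left tinner_sum_left)
qed

text \<open>
  The closest point is no longer than the tensor \<open>w\<close> that represents \<open>A\<close> on the tangent cone.  Both
  \<open>w\<close> and \<open>projection A\<close> are orthogonal sums: the mode parts of \<open>w\<close> also occur in \<open>projection A\<close>,
  and \<open>c\<close> bounds from below the share of \<open>\<parallel>A \<times>\<^sub>k\<^sub>\<in>\<^sub>J P\<^sub>k\<parallel>\<^sup>2\<close> that is left after applying the
  projectors of the remaining modes.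
\<close>

lemma tangent_projection_bound:
  assumes J: "J \<subseteq> {1..d}" "\<And>k. k \<in> J \<Longrightarrow> s k = r k" and A: "A \<in> tensors d n"
    and V: "closest_point_in d n (tangent_cone d n (tucker_variety d n r) X) A V"
    and c: "0 \<le> c" "c \<le> 1"
      "c * tinner d n (mode_prods J P A) (mode_prods J P A) \<le> tinner d n (core_part A) (core_part A)"
  shows "c * (frob d n V)\<^sup>2 \<le> (frob d n (projection A))\<^sup>2"
proof -
  let ?F = "mode_prods J P A"
  let ?w = "\<lambda>i. ?F i + (\<Sum>k\<in>J. mode_part k A i)"
  let ?t = "\<lambda>k. tinner d n (mode_part k A) (mode_part k A)"
  have VT: "V \<in> tangent_cone d n (tucker_variety d n r) X"
    using V by (simp add: closest_point_in_def)
  have fin: "finite J" using J(1) finite_subset by blast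
  have "(frob d n V)\<^sup>2 \<le> tinner d n A V"
    unfolding frob_squared by (rule closest_point_in_cone[OF tangent_cone_scale V])
  also have "\<dots> = tinner d n ?w V" by (rule tinner_tangent[OF J VT A])
  also have "\<dots> \<le> frob d n ?w * frob d n V" by (rule tinner_Cauchy_Schwarz)
  finally have "frob d n V \<le> frob d n ?w"
    using frob_nonneg[of d n V] frob_nonneg[of d n ?w]
    by (cases "frob d n V = 0") (auto simp: power2_eq_square)
  then have "c * (frob d n V)\<^sup>2 \<le> c * (frob d n ?w)\<^sup>2"
    using c(1) by (intro mult_left_mono power_mono) (auto simp: frob_nonneg)
  also have "(frob d n ?w)\<^sup>2 = tinner d n ?F ?F + (\<Sum>k\<in>J. ?t k)"
    unfolding frob_squared using fin J(1)
    by (intro tinner_orthogonal_sum mode_prods_P_orthogonal_mode_part mode_parts_orthogonal) auto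
  also have "c * (tinner d n ?F ?F + (\<Sum>k\<in>J. ?t k)) \<le>
      tinner d n (core_part A) (core_part A) + (\<Sum>k\<in>{1..d}. ?t k)"
  proof -
    have "c * (\<Sum>k\<in>J. ?t k) \<le> 1 * (\<Sum>k\<in>J. ?t k)"
      using c(2) by (intro mult_right_mono sum_nonneg tinner_self_nonneg)
    also have "\<dots> \<le> (\<Sum>k\<in>{1..d}. ?t k)"
      using J(1) by (simp add: sum_mono2 tinner_self_nonneg)
    finally show ?thesis using c(3) by (simp add: distrib_left)
  qed
  finally show ?thesis by (simp add: frob_squared tinner_projection_self)
qed

end

section \<open>The angle condition\<close>

theorem proposition3p3:
  fixes d :: nat
    and n r s :: "nat \<Rightarrow> nat"
    and X G A :: tensor
    and U W :: "nat \<Rightarrow> real mat"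
    and I :: "nat set"
  assumes d_pos: "1 \<le> d"
    and n_pos: "\<forall>k\<in>{1..d}. 1 \<le> n k"
    and r_bounds: "\<forall>k\<in>{1..d}. 1 \<le> r k \<and> r k \<le> min (n k) (codim d n k)"
    and X_variety: "X \<in> tucker_variety d n r"
    and decomposition: "tucker_decomposition d n s X G U"
    and rank_deficient: "\<exists>k\<in>{1..d}. s k \<noteq> r k"
    and I_eq: "I = {k\<in>{1..d}. s k < r k}"
    and A_tensor: "A \<in> tensors d n"
    and choice: "admissible_choice d n r s I U A W"
  shows "tinner d n A (approx_projection d n s I G U W A) =
           (frob d n (approx_projection d n s I G U W A))\<^sup>2 \<and>
         (\<forall>P. closest_point_in d n (tangent_cone d n (tucker_variety d n r) X) A P \<longrightarrow>
           tinner d n A (approx_projection d n s I G U W A) \<ge>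
             sqrt (1 / (real (card I) + 1) *
                   (\<Prod>k\<in>I. real (r k - s k) / real (min (n k) (codim d n k)))) *
             frob d n P * frob d n (approx_projection d n s I G U W A))"
proof -
  define P where "P k = proj_mat (extended_basis I U W k)" for k
  have D: "I \<subseteq> {1..d}" using I_eq by auto
  interpret tucker_point d n s X G U
    by unfold_locales (rule decomposition)
  have W: "W k \<in> carrier_mat (n k) (r k - s k)" "(W k)\<^sup>T * W k = 1\<^sub>m (r k - s k)"
    "(U k)\<^sup>T * W k = 0\<^sub>m (s k) (r k - s k)" if "k \<in> I" for k
    using choice that by (auto simp: admissible_choice_def stiefel_def)
  have basis_rows: "dim_row (extended_basis I U W k) = n k" if "k \<in> {1..d}" for k
    using U_carrier[OF that] W(1)[of k] by (simp add: extended_basis_def hcat_def)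
  interpret enlarged_tucker_point d n s X G U P
  proof
    fix k assume k: "k \<in> {1..d}"
    show "P k \<in> carrier_mat (n k) (n k)"
      using basis_rows[OF k] by (auto simp: P_def proj_mat_def)
    show "(P k)\<^sup>T = P k" by (simp add: P_def proj_mat_transpose)
    show "P k * U k = U k" "P k * P k = P k"
    proof -
      have "P k * U k = U k \<and> P k * P k = P k"
      proof (cases "k \<in> I")
        case True
        then show ?thesis
          using proj_mat_hcat_orthonormal[OF U_carrier[OF k] U_orthonormal[OF k] W(1-3)]
          by (simp add: P_def extended_basis_def)
      next
        case False
        have Ut: "(U k)\<^sup>T \<in> carrier_mat (s k) (n k)" using U_carrier[OF k] by simp
        have PU: "P k * U k = U k"
          using False proj_mat_idempotent[OF U_carrier[OF k] U_orthonormal[OF k]]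
          by (simp add: P_def extended_basis_def)
        have Pk: "P k \<in> carrier_mat (n k) (n k)"
          using basis_rows[OF k] by (auto simp: P_def proj_mat_def)
        have PUU: "P k = U k * (U k)\<^sup>T" using False by (simp add: P_def extended_basis_def proj_mat_def)
        have "P k * (U k * (U k)\<^sup>T) = P k * U k * (U k)\<^sup>T"
          by (rule assoc_mult_mat[OF Pk U_carrier[OF k] Ut, symmetric])
        then have "P k * P k = P k"
          unfolding PU PUU[symmetric] .
        then show ?thesis using PU by simp
      qed
      then show "P k * U k = U k" "P k * P k = P k" by auto
    qed
  qed
  have proj: "approx_projection d n s I G U W A = projection A"
  proof -
    have "proj_perp_mat (extended_basis I U W k) = 1\<^sub>m (n k) - P k" if "k \<in> {1..d}" for k
      using basis_rows[OF that] by (simp add: proj_perp_mat_def P_def proj_mat_def)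
    then show ?thesis
      unfolding approx_projection_def projection_def core_part_def mode_part_def variation_def
        best_variation_def P_def[symmetric] by (intro ext) simp
  qed
  define J where "J = {1..d} - I"
  have J: "J \<subseteq> {1..d}" "k \<in> J \<Longrightarrow> s k = r k" for k
  proof -
    show "J \<subseteq> {1..d}" by (auto simp: J_def)
    assume "k \<in> J"
    then have "k \<in> {1..d}" "\<not> s k < r k" by (auto simp: J_def I_eq)
    then show "s k = r k"
      using X_variety X_rank[of k] by (force simp: tucker_variety_def tucker_rank_def)
  qed
  have finI: "finite I" using D finite_subset by blast
  let ?q = "\<lambda>k. real (r k - s k) / real (min (n k) (codim d n k))"
  define c where "c = (\<Prod>k\<in>I. ?q k)"
  have q: "0 \<le> ?q k \<and> ?q k \<le> 1" if "k \<in> I" for k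
  proof -
    have "1 \<le> r k" "r k \<le> min (n k) (codim d n k)" using r_bounds D that by auto
    then show ?thesis by (auto simp: divide_le_eq_1)
  qed
  have c: "0 \<le> c" "c \<le> 1"
    unfolding c_def using q by (auto intro!: prod_nonneg prod_le_1)
  have core: "c * tinner d n (mode_prods J P A) (mode_prods J P A)
      \<le> tinner d n (core_part A) (core_part A)"
  proof -
    have split: "{1..d} = J \<union> I" "J \<inter> I = {}" and finJ: "finite J"
      using D by (auto simp: J_def)
    have "core_part A = mode_prods J P (mode_prods I P A)"
      unfolding core_part_def split(1) by (rule mode_prods_union[OF finJ finI split(2)])
    also have "mode_prods I P A = mode_prods I (\<lambda>k. proj_mat (hcat (U k) (W k))) A"
      using finI by (intro mode_prods_cong) (auto simp: P_def extended_basis_def)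
    finally have core: "core_part A = mode_prods J P (mode_prods I (\<lambda>k. proj_mat (hcat (U k) (W k))) A)" .
    have PJ: "mode_prods J P B = mode_prods J (\<lambda>k. proj_mat (U k)) B" for B
      using finJ by (intro mode_prods_cong) (auto simp: P_def extended_basis_def J_def)
    have "frob d n (mode_prods J P A) * (\<Prod>k\<in>I. sqrt (?q k)) \<le> frob d n (core_part A)"
      unfolding core PJ using choice unfolding admissible_choice_def J_def by simp
    then have "(frob d n (mode_prods J P A) * (\<Prod>k\<in>I. sqrt (?q k)))\<^sup>2 \<le> (frob d n (core_part A))\<^sup>2"
      using q by (intro power_mono) (auto simp: frob_nonneg prod_nonneg)
    moreover have "(\<Prod>k\<in>I. sqrt (?q k))\<^sup>2 = c"
      unfolding c_def prod_power_distrib using q by (intro prod.cong) auto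
    ultimately show ?thesis by (simp add: power_mult_distrib frob_squared mult.commute)
  qed
  have self: "tinner d n A (projection A) = (frob d n (projection A))\<^sup>2"
    unfolding frob_squared by (rule tinner_projection[OF A_tensor])
  have "sqrt (1 / (real (card I) + 1) * c) * frob d n V * frob d n (projection A)
      \<le> tinner d n A (projection A)"
    if V: "closest_point_in d n (tangent_cone d n (tucker_variety d n r) X) A V" for V
  proof -
    have "1 / (real (card I) + 1) * c \<le> c"
      using c(1) mult_left_mono[of 1 "real (card I) + 1" c] by (simp add: divide_le_eq)
    then have "(1 / (real (card I) + 1) * c) * (frob d n V)\<^sup>2 \<le> (frob d n (projection A))\<^sup>2"
      using tangent_projection_bound[OF J A_tensor V c core]
        mult_right_mono[of "1 / (real (card I) + 1) * c" c "(frob d n V)\<^sup>2"] by simp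
    then have "(sqrt (1 / (real (card I) + 1) * c) * frob d n V)\<^sup>2 \<le> (frob d n (projection A))\<^sup>2"
      using c(1) by (simp add: power_mult_distrib)
    then have "sqrt (1 / (real (card I) + 1) * c) * frob d n V \<le> frob d n (projection A)"
      by (rule power2_le_imp_le) (rule frob_nonneg)
    then show ?thesis
      unfolding self power2_eq_square by (intro mult_right_mono frob_nonneg)
  qed
  then show ?thesis
    unfolding proj c_def[symmetric] using self by blast
qed

end
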